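(* Let $t>0$, $b=\frac1{2t}$, and let $q\in(0,1)$ be determined by $$b=\frac1{2t}=\frac q{(1-q)^2}.$$ Let $\lambda>0$. The grand canonical MNS-model with parameters $t$ and $\lambda$ is a determinantal point process on $\mathbb{R}$ with correlation kernel $$K_\lambda(x,y)=\sum_{n=0}^\infty\frac{\lambda q^{n+1/2}}{1+\lambda q^{n+1/2}}\psi_n(x)\psi_n(y),$$ where $\psi_n(x)=\sqrt{\beta_q}\,h_n(\beta_qx)\,e^{-\beta_q^2x^2/2}$ and $\beta_q=\sqrt{\frac{1+q}{1-q}}$.
   Context: $h_n$, $n\ge0$, are the normalized Hermite polynomials, $h_n(x)=\pi^{-1/4}(2^nn!)^{-1/2}H_n(x)$, orthonormal with respect to $e^{-x^2}dx$ on $\mathbb{R}$. The grand canonical MNS (Moshe-Neuberger-Shapiro) model: let $\phi_t(x,y)=\frac1{\sqrt{2\pi t}}e^{-(x^2+y^2)/2-(x-y)^2/(2t)}$, $Z_0=1$, $Z_N=\int_{\mathbb{R}^N}\det(\phi_t(x_i,x_j))_{1\le i,j\le N}\,d^Nx$, and $Z(\lambda)=\sum_{N\ge0}\frac{\lambda^N}{N!}Z_N$. The point process has exactly $N$ particles with probability $\frac{\lambda^N}{N!}\frac{Z_N}{Z(\lambda)}$, and, given that there are exactly $N$ particles, their positions have density $\frac1{Z_N}\det(\phi_t(x_i,x_j))_{1\le i,j\le N}$ on $\mathbb{R}^N$. A point process on $\mathbb{R}$ is determinantal with correlation kernel $K$ if its correlation functions with respect to Lebesgue measure are $\det(K(x_i,x_j))_{1\le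 i,j\le k}$, $k\ge1$, i.e. $\mathbb{E}[\prod_j(1+g(x_j))]=\sum_{k\ge0}\frac1{k!}\int_{\mathbb{R}^k}\prod_{j=1}^kg(x_j)\det(K(x_i,x_j))_{1\le i,j\le k}\,d^kx$ for bounded measurable $g$ with compact support (product over all particles). *)

theory Defs
  imports "HOL-Probability.Probability" "Jordan_Normal_Form.Determinant"
begin

section \<open>Point processes on the real line\<close>

text \<open>
  A configuration is a locally finite collection of particles, given by its multiplicity function:
  \<open>c x\<close> is the number of particles at \<open>x\<close>. A point process is identified with its law.
\<close>

type_synonym configuration = "real \<Rightarrow> nat"

definition configurations :: "configuration set" where
  "configurations = {c. \<forall>A. compact A \<longrightarrow> finite {x \<in> A. c x \<noteq> 0}}"

definition particle_count :: "real set \<Rightarrow> configuration \<Rightarrow> nat" where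
  "particle_count A c = (\<Sum>x | x \<in> A \<and> c x \<noteq> 0. c x)"

definition configuration_algebra :: "configuration measure" where
  "configuration_algebra = sigma configurations
     {{c \<in> configurations. particle_count A c = n} | A n. A \<in> sets borel \<and> bounded A}"

definition point_process :: "configuration measure \<Rightarrow> bool" where
  "point_process P \<longleftrightarrow> prob_space P \<and> sets P = sets configuration_algebra"

text \<open>
  The product of \<open>1 + g\<close> over all particles, with multiplicity. Particles outside the support of
  \<open>g\<close> contribute the factor \<open>1\<close>, so only finitely many factors remain when that support is compact.
\<close>

definition particle_product :: "(real \<Rightarrow> real) \<Rightarrow> configuration \<Rightarrow> real" where
  "particle_product g c = (\<Prod>x | c x \<noteq> 0 \<and> g x \<noteq> 0. (1 + g x) ^ c x)"

text \<open>
  Points of \<open>\<real>\<^sup>k\<close> are functions on \<open>{..<k}\<close>, and \<open>\<real>\<^sup>k\<close> carries the \<open>k\<close>-fold product of Lebesgue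
  measure. The integrability clauses exclude the default value of a divergent Bochner integral.
\<close>

definition has_correlation_functions ::
    "configuration measure \<Rightarrow> (nat \<Rightarrow> (nat \<Rightarrow> real) \<Rightarrow> real) \<Rightarrow> bool" where
  "has_correlation_functions P \<rho> \<longleftrightarrow>
     (\<forall>g \<in> borel_measurable borel.
        bounded (range g) \<and> compact (closure {x. g x \<noteq> 0}) \<longrightarrow>
        integrable P (particle_product g) \<and>
        (\<forall>k. integrable (Pi\<^sub>M {..<k} (\<lambda>_. lborel)) (\<lambda>x. (\<Prod>j<k. g (x j)) * \<rho> k x)) \<and>
        (\<lambda>k. 1 / fact k * (\<integral>x. (\<Prod>j<k. g (x j)) * \<rho> k x \<partial>Pi\<^sub>M {..<k} (\<lambda>_. lborel)))
          sums (\<integral>c. particle_product g c \<partial>P))"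

definition kernel_det :: "(real \<Rightarrow> real \<Rightarrow> real) \<Rightarrow> nat \<Rightarrow> (nat \<Rightarrow> real) \<Rightarrow> real" where
  "kernel_det K k x = Determinant.det (Matrix.mat k k (\<lambda>(i, j). K (x i) (x j)))"

definition determinantal_point_process ::
    "configuration measure \<Rightarrow> (real \<Rightarrow> real \<Rightarrow> real) \<Rightarrow> bool" where
  "determinantal_point_process P K \<longleftrightarrow>
     point_process P \<and> has_correlation_functions P (kernel_det K)"


section \<open>The grand canonical Moshe--Neuberger--Shapiro model\<close>

definition mns_phi :: "real \<Rightarrow> real \<Rightarrow> real \<Rightarrow> real" where
  "mns_phi t x y = 1 / sqrt (2 * pi * t) * exp (- (x\<^sup>2 + y\<^sup>2) / 2 - (x - y)\<^sup>2 / (2 * t))"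

definition mns_Z_canonical :: "real \<Rightarrow> nat \<Rightarrow> real" where
  "mns_Z_canonical t N = (\<integral>x. kernel_det (mns_phi t) N x \<partial>Pi\<^sub>M {..<N} (\<lambda>_. lborel))"

lemma mns_Z_canonical_0: "mns_Z_canonical t 0 = 1"
  by (simp add: mns_Z_canonical_def kernel_det_def PiM_empty lebesgue_integral_count_space_finite)

definition mns_Z :: "real \<Rightarrow> real \<Rightarrow> real" where
  "mns_Z t lam = (\<Sum>N. lam ^ N / fact N * mns_Z_canonical t N)"

definition configuration_of :: "nat \<Rightarrow> (nat \<Rightarrow> real) \<Rightarrow> configuration" where
  "configuration_of N x = (\<lambda>y. card {i. i < N \<and> x i = y})"

text \<open>The conditional law of the configuration given that there are exactly \<open>N\<close> particles:\<close>

definition mns_canonical :: "real \<Rightarrow> nat \<Rightarrow> configuration measure" where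
  "mns_canonical t N =
     distr (density (Pi\<^sub>M {..<N} (\<lambda>_. lborel))
              (\<lambda>x. ennreal (1 / mns_Z_canonical t N * kernel_det (mns_phi t) N x)))
       configuration_algebra (configuration_of N)"

definition mns_particle_number :: "real \<Rightarrow> real \<Rightarrow> nat measure" where
  "mns_particle_number t lam =
     density (count_space UNIV)
       (\<lambda>N. ennreal (lam ^ N / fact N * (mns_Z_canonical t N / mns_Z t lam)))"

text \<open>
  The grand canonical model is the mixture over \<open>N\<close>. That the weights and densities are nonnegative
  and of total mass one is not built in here; it is part of \<^const>\<open>point_process\<close>.
\<close>

definition mns_grand_canonical :: "real \<Rightarrow> real \<Rightarrow> configuration measure" where
  "mns_grand_canonical t lam = Giry_Monad.bind (mns_particle_number t lam) (mns_canonical t)"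


section \<open>Hermite functions and the correlation kernel\<close>

text \<open>The physicists' Hermite polynomials, by Rodrigues' formula.\<close>

definition hermite :: "nat \<Rightarrow> real \<Rightarrow> real" where
  "hermite n x = (-1) ^ n * exp (x\<^sup>2) * (deriv ^^ n) (\<lambda>y. exp (- y\<^sup>2)) x"

definition normalized_hermite :: "nat \<Rightarrow> real \<Rightarrow> real" where
  "normalized_hermite n x = pi powr (- 1 / 4) * (2 ^ n * fact n) powr (- 1 / 2) * hermite n x"

definition mns_beta :: "real \<Rightarrow> real" where
  "mns_beta q = sqrt ((1 + q) / (1 - q))"

definition mns_psi :: "real \<Rightarrow> nat \<Rightarrow> real \<Rightarrow> real" where
  "mns_psi q n x = sqrt (mns_beta q) * normalized_hermite n (mns_beta q * x)
                     * exp (- ((mns_beta q)\<^sup>2 * x\<^sup>2) / 2)"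

definition mns_kernel_term :: "real \<Rightarrow> real \<Rightarrow> real \<Rightarrow> real \<Rightarrow> nat \<Rightarrow> real" where
  "mns_kernel_term q lam x y n =
     lam * q powr (real n + 1 / 2) / (1 + lam * q powr (real n + 1 / 2)) * mns_psi q n x * mns_psi q n y"

definition mns_kernel :: "real \<Rightarrow> real \<Rightarrow> real \<Rightarrow> real \<Rightarrow> real" where
  "mns_kernel q lam x y = (\<Sum>n. mns_kernel_term q lam x y n)"

lemma ex1_q:
  fixes b :: real
  assumes b: "b > 0"
  shows "\<exists>!q. 0 < q \<and> q < 1 \<and> b = q / (1 - q)\<^sup>2"
proof
  define r where "r = sqrt (1 + 4 * b)"
  have r: "r > 1" "r\<^sup>2 = 1 + 4 * b"
    using b by (auto simp: r_def)
  have "1 - (r - 1) / (r + 1) = 2 / (r + 1)"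
    using r by (simp add: field_simps)
  then have "(r - 1) / (r + 1) / (1 - (r - 1) / (r + 1))\<^sup>2 = (r - 1) * (r + 1) / 4"
    using r by (simp add: power2_eq_square field_simps)
  also have "\<dots> = b"
    using r by (simp add: power2_eq_square algebra_simps)
  finally show "0 < (r - 1) / (r + 1) \<and> (r - 1) / (r + 1) < 1 \<and>
      b = (r - 1) / (r + 1) / (1 - (r - 1) / (r + 1))\<^sup>2"
    using r by simp
  fix q assume q: "0 < q \<and> q < 1 \<and> b = q / (1 - q)\<^sup>2"
  then have "b * (1 - q)\<^sup>2 = q"
    by simp
  then have "(1 + q)\<^sup>2 = (1 + 4 * b) * (1 - q)\<^sup>2"
    by (simp add: power2_eq_square algebra_simps)
  then have "((1 + q) / (1 - q))\<^sup>2 = 1 + 4 * b"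
    using q by (simp add: power_divide)
  then have "r = (1 + q) / (1 - q)"
    unfolding r_def using q by (intro real_sqrt_unique) auto
  then have "r * (1 - q) = 1 + q"
    using q by (simp add: field_simps)
  then show "q = (r - 1) / (r + 1)"
    using r by (simp add: field_simps)
qed

end

theory Submission
  imports Defs
begin

text \<open>
  Mehler's formula diagonalises the one-particle kernel, \<open>\<phi>\<^sub>t(x, y) = \<Sum>n. q\<^bsup>n+1/2\<^esup> \<psi>\<^sub>n(x) \<psi>\<^sub>n(y)\<close>; it is
  obtained from a differential equation in the expansion parameter. For a kernel
  \<open>k(x, y) = \<Sum>n. w\<^sub>n \<psi>\<^sub>n(x) \<psi>\<^sub>n(y)\<close> with orthonormal \<open>\<psi>\<^sub>n\<close> and summable \<open>w\<^sub>n \<ge> 0\<close>, truncation at \<open>n < m\<close>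
  turns the series \<open>\<Sum>N. 1/N! \<integral> \<Prod>h(x\<^sub>i) det(k(x\<^sub>i, x\<^sub>j))\<close> into the \<open>m \<times> m\<close> determinant \<open>det(I + W H)\<close>, where
  \<open>H\<^sub>i\<^sub>j = \<integral> h \<psi>\<^sub>i \<psi>\<^sub>j\<close>. The truncated densities increase with \<open>m\<close>, being sums of squares, so the limit
  \<open>m \<rightarrow> \<infinity>\<close> can be taken on both sides. Applied to \<open>h = 1 + g\<close> with \<open>w\<^sub>n = \<lambda>q\<^bsup>n+1/2\<^esup>\<close>, and to \<open>h = g\<close> with
  \<open>w\<^sub>n = \<lambda>q\<^bsup>n+1/2\<^esup> / (1 + \<lambda>q\<^bsup>n+1/2\<^esup>)\<close>, the two finite determinants differ by the factor
  \<open>\<Prod>n<m. 1 + \<lambda>q\<^bsup>n+1/2\<^esup>\<close>, which tends to \<open>Z(\<lambda>)\<close>.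
\<close>


section \<open>Determinants over finite index sets\<close>

text \<open>The Leibniz sum over an arbitrary index set, so that principal minors and relabelled
  matrices are instances of it without renumbering rows. The empty index set gives 1.\<close>

definition index_det :: "'i set \<Rightarrow> ('i \<Rightarrow> 'i \<Rightarrow> real) \<Rightarrow> real" where
  "index_det I A = (\<Sum>p | p permutes I. of_int (sign p) * (\<Prod>i\<in>I. A i (p i)))"

lemma kernel_det_eq_index_det: "kernel_det K k x = index_det {..<k} (\<lambda>i j. K (x i) (x j))"
proof -
  have "p i < k" if "p permutes {0..<k}" "i < k" for p i
    using permutes_in_image[OF that(1), of i] that(2) by auto
  then have "kernel_det K k x = (\<Sum>p | p permutes {0..<k}. signof p * (\<Prod>i = 0..<k. K (x i) (x (p i))))"
    unfolding kernel_det_def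
    by (subst det_def'[of _ k]) (auto intro!: sum.cong prod.cong)
  then show ?thesis
    by (simp add: index_det_def atLeast0LessThan)
qed

lemma index_det_scale_rows: "index_det I (\<lambda>i j. c i * A i j) = (\<Prod>i\<in>I. c i) * index_det I A"
  by (simp add: index_det_def prod.distrib sum_distrib_left mult_ac)

lemma index_det_permute_rows:
  assumes I: "finite I" and s: "s permutes I"
  shows "index_det I (\<lambda>i j. A (s i) j) = of_int (sign s) * index_det I A"
proof -
  have "index_det I (\<lambda>i j. A (s i) j) =
      (\<Sum>p | p permutes I. of_int (sign (p \<circ> s)) * (\<Prod>i\<in>I. A (s i) ((p \<circ> s) i)))"
    unfolding index_det_def by (rule sum_permutations_compose_right[OF s])
  also have "\<dots> = (\<Sum>p | p permutes I. of_int (sign s) * (of_int (sign p) * (\<Prod>i\<in>I. A i (p i))))"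
  proof (rule sum.cong[OF refl])
    fix p assume "p \<in> {p. p permutes I}"
    then have p: "p permutes I" by simp
    have "(\<Prod>i\<in>I. A (s i) ((p \<circ> s) i)) = (\<Prod>i\<in>I. A i (p i))"
      using prod.permute[OF s, of "\<lambda>i. A i (p i)"] by (simp add: o_def)
    then show "of_int (sign (p \<circ> s)) * (\<Prod>i\<in>I. A (s i) ((p \<circ> s) i)) =
        of_int (sign s) * (of_int (sign p) * (\<Prod>i\<in>I. A i (p i)))"
      using p s I by (simp add: sign_compose permutes_imp_permutation)
  qed
  finally show ?thesis by (simp add: index_det_def sum_distrib_left)
qed

lemma index_det_transpose:
  assumes I: "finite I"
  shows "index_det I (\<lambda>i j. A j i) = index_det I A"
proof -
  let ?inv = Hilbert_Choice.inv
  have "index_det I (\<lambda>i j. A j i) =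
      (\<Sum>p | p permutes I. of_int (sign (?inv p)) * (\<Prod>i\<in>I. A (?inv p i) i))"
    unfolding index_det_def by (rule sum_permutations_inverse)
  also have "\<dots> = index_det I A"
    unfolding index_det_def
  proof (rule sum.cong[OF refl])
    fix p assume "p \<in> {p. p permutes I}"
    then have p: "p permutes I" by simp
    have "(\<Prod>i\<in>I. A (?inv p i) i) = (\<Prod>i\<in>I. A i (p i))"
      using prod.permute[OF p, of "\<lambda>i. A (?inv p i) i"] by (simp add: o_def permutes_inverses[OF p])
    moreover have "sign (?inv p) = sign p"
      using p I by (intro sign_inverse permutes_imp_permutation)
    ultimately show "of_int (sign (?inv p)) * (\<Prod>i\<in>I. A (?inv p i) i) = of_int (sign p) * (\<Prod>i\<in>I. A i (p i))"
      by simp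
  qed
  finally show ?thesis .
qed

text \<open>The transposition of \<open>i\<close> and \<open>k\<close> leaves the rows unchanged and
  has sign -1, so the determinant equals its own negative.\<close>

lemma index_det_equal_rows:
  assumes I: "finite I" and ik: "i \<in> I" "k \<in> I" "i \<noteq> k" and eq: "A i = A k"
  shows "index_det I A = 0"
proof -
  let ?s = "Transposition.transpose i k"
  have "A (?s l) = A l" for l
    using eq by (auto simp: Transposition.transpose_def)
  then have "index_det I A = of_int (sign ?s) * index_det I A"
    using index_det_permute_rows[OF I permutes_swap_id[OF ik(1,2)], of A] by simp
  then show ?thesis
    using ik(3) by (simp add: sign_swap_id)
qed

lemma index_det_image:
  assumes I: "finite I" and f: "inj_on f I"
  shows "index_det (f ` I) A = index_det I (\<lambda>i j. A (f i) (f j))"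
proof -
  have bij: "bij_betw f I (f ` I)"
    using f by (rule inj_on_imp_bij_betw)
  have "index_det I (\<lambda>i j. A (f i) (f j)) =
      (\<Sum>p | p permutes I. of_int (sign (map_permutation I f p)) * (\<Prod>i\<in>f ` I. A i (map_permutation I f p i)))"
    unfolding index_det_def using f I
    by (intro sum.cong) (auto simp: prod.reindex sign_map_permutation map_permutation_apply)
  also have "\<dots> = index_det (f ` I) A"
    unfolding index_det_def
  proof (rule sum.reindex_bij_betw)
    show "bij_betw (map_permutation I f) {p. p permutes I} {p. p permutes f ` I}"
    proof (rule bij_betw_byWitness[where f' = "map_permutation (f ` I) (inv_into I f)"])
      show "\<forall>p\<in>{p. p permutes I}. map_permutation (f ` I) (inv_into I f) (map_permutation I f p) = p"
        using f bij by (auto intro!: map_permutation_compose_inv)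
      show "\<forall>p\<in>{p. p permutes f ` I}. map_permutation I f (map_permutation (f ` I) (inv_into I f) p) = p"
        using bij
        by (intro ballI map_permutation_compose_inv[where A = "f ` I"] bij_betw_inv_into) (auto simp: f_inv_into_f)
      show "map_permutation I f ` {p. p permutes I} \<subseteq> {p. p permutes f ` I}"
        using bij by (auto intro: map_permutation_permutes)
      show "map_permutation (f ` I) (inv_into I f) ` {p. p permutes f ` I} \<subseteq> {p. p permutes I}"
        using bij by (auto intro: map_permutation_permutes bij_betw_inv_into)
    qed
  qed
  finally show ?thesis ..
qed

lemma index_det_diag:
  assumes I: "finite I" and A: "\<And>i j. i \<in> I \<Longrightarrow> j \<in> I \<Longrightarrow> i \<noteq> j \<Longrightarrow> A i j = 0"
  shows "index_det I A = (\<Prod>i\<in>I. A i i)"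
proof -
  have "(\<Prod>i\<in>I. A i (p i)) = 0" if p: "p permutes I" "p \<noteq> id" for p
  proof -
    obtain i where i: "p i \<noteq> i" using p(2) by (auto simp: fun_eq_iff)
    then have "i \<in> I" using p(1) by (metis permutes_not_in)
    with i p show ?thesis
      by (intro prod_zero[OF I] bexI[of _ i] A) (auto simp: permutes_in_image)
  qed
  then have "index_det I A = (\<Sum>p\<in>{id}. of_int (sign p) * (\<Prod>i\<in>I. A i (p i)))"
    unfolding index_det_def using I
    by (intro sum.mono_neutral_right) (auto simp: finite_permutations permutes_id)
  then show ?thesis by simp
qed

section \<open>Principal minors and sums over index maps\<close>

lemma index_det_one_plus:
  assumes U: "finite U"
  shows "index_det U (\<lambda>i j. (if i = j then 1 else 0) + A i j) = (\<Sum>S\<in>Pow U. index_det S A)"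
proof -
  let ?P = "{p. p permutes U}"
  let ?d = "\<lambda>i j. if i = j then 1 else 0 :: real"
  \<comment> \<open>Each product is multiplied out: an index in \<open>S\<close> takes its entry
    from \<open>A\<close>, an index outside takes it from the identity matrix.\<close>
  have "index_det U (\<lambda>i j. ?d i j + A i j) =
      (\<Sum>p\<in>?P. \<Sum>S\<in>Pow U. of_int (sign p) * ((\<Prod>i\<in>S. A i (p i)) * (\<Prod>i\<in>U - S. ?d i (p i))))"
    unfolding index_det_def by (subst add.commute, subst prod_add[OF U]) (simp add: sum_distrib_left)
  also have "\<dots> = (\<Sum>S\<in>Pow U. \<Sum>p\<in>?P. of_int (sign p) * ((\<Prod>i\<in>S. A i (p i)) * (\<Prod>i\<in>U - S. ?d i (p i))))"
    by (rule sum.swap)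
  also have "\<dots> = (\<Sum>S\<in>Pow U. index_det S A)"
  proof (rule sum.cong[OF refl])
    fix S assume "S \<in> Pow U"
    then have S: "S \<subseteq> U" by simp
    have "(\<Sum>p\<in>?P. of_int (sign p) * ((\<Prod>i\<in>S. A i (p i)) * (\<Prod>i\<in>U - S. ?d i (p i)))) =
        (\<Sum>p | p permutes S. of_int (sign p) * ((\<Prod>i\<in>S. A i (p i)) * (\<Prod>i\<in>U - S. ?d i (p i))))"
    proof (rule sum.mono_neutral_right)
      show "finite ?P" using U by (rule finite_permutations)
      show "{p. p permutes S} \<subseteq> ?P" using S by (auto intro: permutes_subset)
      show "\<forall>p\<in>?P - {p. p permutes S}.
          of_int (sign p) * ((\<Prod>i\<in>S. A i (p i)) * (\<Prod>i\<in>U - S. ?d i (p i))) = 0"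
      proof
        fix p assume p: "p \<in> ?P - {p. p permutes S}"
        \<comment> \<open>A permutation of \<open>U\<close> that fixes every point outside
          \<open>S\<close> is a permutation of \<open>S\<close>. All others meet a zero off-diagonal
          entry of the identity.\<close>
        then have "\<exists>i\<in>U - S. p i \<noteq> i"
          using permutes_superset[of p U S] by auto
        then have "(\<Prod>i\<in>U - S. ?d i (p i)) = 0"
          using U by (intro prod_zero) force+
        then show "of_int (sign p) * ((\<Prod>i\<in>S. A i (p i)) * (\<Prod>i\<in>U - S. ?d i (p i))) = 0"
          by simp
      qed
    qed
    also have "\<dots> = index_det S A"
      unfolding index_det_def by (intro sum.cong) (auto simp: permutes_not_in intro!: prod.neutral)
    finally show "(\<Sum>p\<in>?P. of_int (sign p) * ((\<Prod>i\<in>S. A i (p i)) * (\<Prod>i\<in>U - S. ?d i (p i)))) = index_det S A" .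
  qed
  finally show ?thesis .
qed

text \<open>Between finite sets of equal size injective maps are onto, so the falling factorial
  counts the labellings of \<open>S\<close>.\<close>

lemma card_bij_PiE:
  assumes "finite S" "card S = N"
  shows "card {f \<in> {..<N} \<rightarrow>\<^sub>E S. inj_on f {..<N} \<and> f ` {..<N} = S} = fact N"
proof -
  have "f ` {..<N} = S" if "f \<in> {..<N} \<rightarrow>\<^sub>E S" "inj_on f {..<N}" for f
    using that assms by (intro card_subset_eq) (auto simp: card_image)
  then have "{f \<in> {..<N} \<rightarrow>\<^sub>E S. inj_on f {..<N} \<and> f ` {..<N} = S} = {f \<in> {..<N} \<rightarrow>\<^sub>E S. inj_on f {..<N}}"
    by auto
  then show ?thesis
    using card_inj_on_subset_funcset[of "{..<N}" S "{..<N}"] assms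
    by (simp add: fact_prod_rev)
qed

text \<open>A map that repeats a value produces two equal rows and contributes nothing. The
  injective maps are grouped by image; all \<open>fact N\<close> labellings of a set
  \<open>S\<close> give the same principal minor.\<close>

lemma sum_index_det_PiE:
  assumes U: "finite U"
  shows "(\<Sum>f\<in>{..<N} \<rightarrow>\<^sub>E U. index_det {..<N} (\<lambda>i j. A (f i) (f j))) =
    fact N * (\<Sum>S | S \<subseteq> U \<and> card S = N. index_det S A)"
proof -
  let ?F = "{f \<in> {..<N} \<rightarrow>\<^sub>E U. inj_on f {..<N}}"
  let ?T = "{S. S \<subseteq> U \<and> card S = N}"
  have fin: "finite ({..<N} \<rightarrow>\<^sub>E U)" using U by (intro finite_PiE) auto
  have "(\<Sum>f\<in>{..<N} \<rightarrow>\<^sub>E U. index_det {..<N} (\<lambda>i j. A (f i) (f j))) =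
      (\<Sum>f\<in>?F. index_det {..<N} (\<lambda>i j. A (f i) (f j)))"
  proof (rule sum.mono_neutral_right[OF fin])
    show "\<forall>f\<in>({..<N} \<rightarrow>\<^sub>E U) - ?F. index_det {..<N} (\<lambda>i j. A (f i) (f j)) = 0"
    proof
      fix f assume "f \<in> ({..<N} \<rightarrow>\<^sub>E U) - ?F"
      then obtain i k where "i \<in> {..<N}" "k \<in> {..<N}" "i \<noteq> k" "f i = f k"
        by (auto simp: inj_on_def)
      then show "index_det {..<N} (\<lambda>i j. A (f i) (f j)) = 0"
        by (intro index_det_equal_rows[of _ i k]) auto
    qed
  qed auto
  also have "\<dots> = (\<Sum>f\<in>?F. index_det (f ` {..<N}) A)"
    by (intro sum.cong) (auto simp: index_det_image)
  also have "\<dots> = (\<Sum>S\<in>?T. \<Sum>f | f \<in> ?F \<and> f ` {..<N} = S. index_det (f ` {..<N}) A)"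
  proof (rule sum.group[symmetric])
    show "finite ?F" using fin by simp
    show "finite ?T" using U by simp
    show "(\<lambda>f. f ` {..<N}) ` ?F \<subseteq> ?T"
      by (auto simp: card_image PiE_iff)
  qed
  also have "\<dots> = (\<Sum>S\<in>?T. fact N * index_det S A)"
  proof (rule sum.cong[OF refl])
    fix S assume "S \<in> ?T"
    then have S: "S \<subseteq> U" "card S = N" by auto
    have "{f. f \<in> ?F \<and> f ` {..<N} = S} = {f \<in> {..<N} \<rightarrow>\<^sub>E S. inj_on f {..<N} \<and> f ` {..<N} = S}"
      using S(1) by (auto simp: PiE_iff)
    then have "card {f. f \<in> ?F \<and> f ` {..<N} = S} = fact N"
      using card_bij_PiE[OF finite_subset[OF S(1) U] S(2)] by simp
    then show "(\<Sum>f | f \<in> ?F \<and> f ` {..<N} = S. index_det (f ` {..<N}) A) = fact N * index_det S A"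
      by simp
  qed
  finally show ?thesis by (simp add: sum_distrib_left)
qed

text \<open>The Fredholm expansion of a finite matrix: \<open>fact N\<close> cancels, and the minors
  of all sizes add up to the determinant of identity plus \<open>A\<close>. Any \<open>n\<close>
  bounding the size of \<open>U\<close> will do, as there are no larger minors.\<close>

lemma sum_sum_index_det_PiE:
  assumes U: "finite U" and n: "card U \<le> n"
  shows "(\<Sum>N\<le>n. 1 / fact N * (\<Sum>f\<in>{..<N} \<rightarrow>\<^sub>E U. index_det {..<N} (\<lambda>i j. A (f i) (f j)))) =
    index_det U (\<lambda>i j. (if i = j then 1 else 0) + A i j)"
proof -
  have "(\<Sum>N\<le>n. 1 / fact N * (\<Sum>f\<in>{..<N} \<rightarrow>\<^sub>E U. index_det {..<N} (\<lambda>i j. A (f i) (f j)))) =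
      (\<Sum>N\<le>n. \<Sum>S | S \<in> Pow U \<and> card S = N. index_det S A)"
    by (simp add: sum_index_det_PiE[OF U])
  also have "\<dots> = (\<Sum>S\<in>Pow U. index_det S A)"
    using U n card_mono[OF U] by (intro sum.group) (auto intro: order_trans)
  finally show ?thesis using index_det_one_plus[OF U] by simp
qed

section \<open>Fredholm expansions\<close>

text \<open>Since \<open>s\<close> fixes the points outside \<open>I\<close>, precomposition
  preserves extensionality; the inverse permutation undoes it.\<close>

lemma permutes_comp_PiE_bij:
  assumes s: "s permutes I"
  shows "bij_betw (\<lambda>f. f \<circ> s) (I \<rightarrow>\<^sub>E U) (I \<rightarrow>\<^sub>E U)"
proof (rule bij_betw_byWitness[where f' = "\<lambda>f. f \<circ> Hilbert_Choice.inv s"])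
  have closed: "(\<lambda>f. f \<circ> p) ` (I \<rightarrow>\<^sub>E U) \<subseteq> (I \<rightarrow>\<^sub>E U)" if "p permutes I" for p
    using that by (auto simp: PiE_iff extensional_def permutes_in_image permutes_not_in)
  show "(\<lambda>f. f \<circ> s) ` (I \<rightarrow>\<^sub>E U) \<subseteq> (I \<rightarrow>\<^sub>E U)"
    by (rule closed[OF s])
  show "(\<lambda>f. f \<circ> Hilbert_Choice.inv s) ` (I \<rightarrow>\<^sub>E U) \<subseteq> (I \<rightarrow>\<^sub>E U)"
    by (rule closed[OF permutes_inv[OF s]])
qed (simp_all add: comp_assoc permutes_inv_o[OF s])

text \<open>Summability on the diagonal is required at every \<open>x\<close>, so that the kernel is
  a pointwise convergent series everywhere, not merely almost everywhere.\<close>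

locale orthonormal_expansion =
  fixes \<psi> :: "nat \<Rightarrow> real \<Rightarrow> real" and w :: "nat \<Rightarrow> real"
  assumes measurable_psi [measurable]: "\<And>n. \<psi> n \<in> borel_measurable borel"
    and integrable_psi: "\<And>i j. integrable lborel (\<lambda>x. \<psi> i x * \<psi> j x)"
    and orthonormal: "\<And>i j. (\<integral>x. \<psi> i x * \<psi> j x \<partial>lborel) = (if i = j then 1 else 0)"
    and w_nonneg: "\<And>n. 0 \<le> w n"
    and summable_w: "summable w"
    and summable_diagonal: "\<And>x. summable (\<lambda>n. w n * (\<psi> n x)\<^sup>2)"
begin

definition kernel_upto :: "nat \<Rightarrow> real \<Rightarrow> real \<Rightarrow> real" where
  "kernel_upto m x y = (\<Sum>n<m. w n * \<psi> n x * \<psi> n y)"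

definition kernel :: "real \<Rightarrow> real \<Rightarrow> real" where
  "kernel x y = (\<Sum>n. w n * \<psi> n x * \<psi> n y)"

text \<open>Matrix entries of multiplication by \<open>h\<close> in the orthonormal system;
  \<open>h = 1\<close> gives the identity matrix.\<close>

definition gram :: "(real \<Rightarrow> real) \<Rightarrow> nat \<Rightarrow> nat \<Rightarrow> real" where
  "gram h i j = (\<integral>x. h x * (\<psi> i x * \<psi> j x) \<partial>lborel)"

text \<open>By the bound |ab| \<le> a^2 + b^2, each term is dominated by the two corresponding
  diagonal terms.\<close>

lemma summable_kernel: "summable (\<lambda>n. w n * \<psi> n x * \<psi> n y)"
proof (rule summable_comparison_test')
  show "summable (\<lambda>n. w n * (\<psi> n x)\<^sup>2 + w n * (\<psi> n y)\<^sup>2)"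
    by (intro summable_add summable_diagonal)
  show "norm (w n * \<psi> n x * \<psi> n y) \<le> w n * (\<psi> n x)\<^sup>2 + w n * (\<psi> n y)\<^sup>2" for n
  proof -
    have "\<bar>\<psi> n x\<bar> * \<bar>\<psi> n y\<bar> \<le> (\<psi> n x)\<^sup>2 + (\<psi> n y)\<^sup>2"
      using sum_squares_bound[of "\<bar>\<psi> n x\<bar>" "\<bar>\<psi> n y\<bar>"]
        zero_le_mult_iff[of "\<bar>\<psi> n x\<bar>" "\<bar>\<psi> n y\<bar>"]
      unfolding power2_abs by linarith
    from mult_left_mono[OF this w_nonneg] show ?thesis
      by (simp add: abs_mult w_nonneg algebra_simps)
  qed
qed

lemma kernel_upto_tendsto: "(\<lambda>m. kernel_upto m x y) \<longlonglongrightarrow> kernel x y"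
  unfolding kernel_upto_def kernel_def by (rule summable_LIMSEQ[OF summable_kernel])

abbreviation det_upto :: "nat \<Rightarrow> nat \<Rightarrow> (nat \<Rightarrow> real) \<Rightarrow> real" where
  "det_upto m N x \<equiv> index_det {..<N} (\<lambda>i j. kernel_upto m (x i) (x j))"

abbreviation det_kernel :: "nat \<Rightarrow> (nat \<Rightarrow> real) \<Rightarrow> real" where
  "det_kernel N x \<equiv> index_det {..<N} (\<lambda>i j. kernel (x i) (x j))"

lemma measurable_det_upto [measurable]:
  "det_upto m N \<in> borel_measurable (Pi\<^sub>M {..<N} (\<lambda>_. lborel))"
proof -
  have "(\<lambda>x. \<Prod>i<N. kernel_upto m (x i) (x (p i))) \<in> borel_measurable (Pi\<^sub>M {..<N} (\<lambda>_. lborel))"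
    if p: "p permutes {..<N}" for p
    unfolding kernel_upto_def
  proof (intro borel_measurable_prod borel_measurable_sum borel_measurable_times borel_measurable_const)
    fix i n assume "i \<in> {..<N}"
    \<comment> \<open>Coordinates are measurable only for indices of the product space, so
      \<open>p i\<close> must be one of them.\<close>
    moreover then have "p i \<in> {..<N}" using p by (simp only: permutes_in_image)
    ultimately show "(\<lambda>x. \<psi> n (x i)) \<in> borel_measurable (Pi\<^sub>M {..<N} (\<lambda>_. lborel))"
      "(\<lambda>x. \<psi> n (x (p i))) \<in> borel_measurable (Pi\<^sub>M {..<N} (\<lambda>_. lborel))"
      by (auto intro!: measurable_compose[OF measurable_component_singleton] simp: measurable_lborel1)
  qed
  then show ?thesis
    unfolding index_det_def by (intro borel_measurable_sum borel_measurable_times) auto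
qed

text \<open>Multilinearity in the rows: \<open>f i\<close> is the summand of the truncated kernel
  chosen in row \<open>i\<close>, and the factors that depend only on the row leave the
  determinant.\<close>

lemma det_upto_expand:
  "det_upto m N x = (\<Sum>f\<in>{..<N} \<rightarrow>\<^sub>E {..<m}.
     (\<Prod>i<N. w (f i)) * ((\<Prod>i<N. \<psi> (f i) (x i)) * index_det {..<N} (\<lambda>i j. \<psi> (f i) (x j))))"
proof -
  let ?F = "{..<N} \<rightarrow>\<^sub>E {..<m}"
  have "det_upto m N x = (\<Sum>p | p permutes {..<N}. of_int (sign p) *
      (\<Sum>f\<in>?F. \<Prod>i<N. w (f i) * \<psi> (f i) (x i) * \<psi> (f i) (x (p i))))"
    unfolding index_det_def kernel_upto_def by (subst prod_sum_PiE) auto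
  also have "\<dots> = (\<Sum>f\<in>?F. \<Sum>p | p permutes {..<N}. of_int (sign p) *
      (\<Prod>i<N. w (f i) * \<psi> (f i) (x i) * \<psi> (f i) (x (p i))))"
    by (subst sum.swap) (simp add: sum_distrib_left)
  finally show ?thesis
    by (simp add: index_det_def sum_distrib_left prod.distrib mult_ac)
qed

text \<open>Averaging the expansion over all relabellings \<open>f \<circ> s\<close> turns it into a sum of squares.\<close>

lemma det_upto_symmetrized:
  "fact N * det_upto m N x = (\<Sum>f\<in>{..<N} \<rightarrow>\<^sub>E {..<m}.
     (\<Prod>i<N. w (f i)) * (index_det {..<N} (\<lambda>i j. \<psi> (f i) (x j)))\<^sup>2)"
proof -
  let ?F = "{..<N} \<rightarrow>\<^sub>E {..<m}" and ?P = "{p. p permutes {..<N}}"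
  let ?D = "\<lambda>f. index_det {..<N} (\<lambda>i j. \<psi> (f i) (x j))"
  let ?W = "\<lambda>f. \<Prod>i<N. w (f i)"
  have "det_upto m N x = (\<Sum>f\<in>?F. ?W f * ((of_int (sign s) * (\<Prod>i<N. \<psi> (f (s i)) (x i))) * ?D f))"
    if s: "s permutes {..<N}" for s
  proof -
    have "det_upto m N x = (\<Sum>f\<in>?F. ?W (f \<circ> s) * ((\<Prod>i<N. \<psi> ((f \<circ> s) i) (x i)) * ?D (f \<circ> s)))"
      unfolding det_upto_expand by (rule sum.reindex_bij_betw[OF permutes_comp_PiE_bij[OF s], symmetric])
    also have "\<dots> = (\<Sum>f\<in>?F. ?W f * ((of_int (sign s) * (\<Prod>i<N. \<psi> (f (s i)) (x i))) * ?D f))"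
    proof (rule sum.cong[OF refl])
      fix f
      have "?W (f \<circ> s) = ?W f"
        using prod.permute[OF s, of "\<lambda>i. w (f i)"] by (simp add: o_def)
      moreover have "?D (f \<circ> s) = of_int (sign s) * ?D f"
        using index_det_permute_rows[OF _ s, of "\<lambda>i j. \<psi> (f i) (x j)"] by simp
      ultimately show "?W (f \<circ> s) * ((\<Prod>i<N. \<psi> ((f \<circ> s) i) (x i)) * ?D (f \<circ> s)) =
          ?W f * ((of_int (sign s) * (\<Prod>i<N. \<psi> (f (s i)) (x i))) * ?D f)"
        by simp
    qed
    finally show ?thesis .
  qed
  then have "(\<Sum>s\<in>?P. det_upto m N x) =
      (\<Sum>s\<in>?P. \<Sum>f\<in>?F. ?W f * ((of_int (sign s) * (\<Prod>i<N. \<psi> (f (s i)) (x i))) * ?D f))"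
    by (intro sum.cong) auto
  also have "\<dots> = (\<Sum>f\<in>?F. \<Sum>s\<in>?P. ?W f * ((of_int (sign s) * (\<Prod>i<N. \<psi> (f (s i)) (x i))) * ?D f))"
    by (rule sum.swap)
  \<comment> \<open>The signed products summed over \<open>s\<close> form the Leibniz sum of the
    transposed matrix.\<close>
  also have "\<dots> = (\<Sum>f\<in>?F. ?W f * (index_det {..<N} (\<lambda>i j. \<psi> (f j) (x i)) * ?D f))"
    by (simp add: index_det_def sum_distrib_left sum_distrib_right mult_ac)
  also have "\<dots> = (\<Sum>f\<in>?F. ?W f * (?D f)\<^sup>2)"
    by (intro sum.cong) (auto simp: index_det_transpose[of _ "\<lambda>i j. \<psi> (_ i) (x j)"] power2_eq_square)
  finally show ?thesis
    using card_permutations[of "{..<N}" N] by simp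
qed

lemma det_upto_eq_squares:
  "det_upto m N x = (\<Sum>f\<in>{..<N} \<rightarrow>\<^sub>E {..<m}.
     (\<Prod>i<N. w (f i)) * (index_det {..<N} (\<lambda>i j. \<psi> (f i) (x j)))\<^sup>2) / fact N"
  using det_upto_symmetrized[of N m x] by (simp add: field_simps)

lemma det_upto_nonneg: "0 \<le> det_upto m N x"
  unfolding det_upto_eq_squares
  by (intro divide_nonneg_pos sum_nonneg mult_nonneg_nonneg prod_nonneg) (auto simp: w_nonneg)

lemma det_upto_mono: "m \<le> m' \<Longrightarrow> det_upto m N x \<le> det_upto m' N x"
  unfolding det_upto_eq_squares
  by (intro divide_right_mono sum_mono2 mult_nonneg_nonneg prod_nonneg PiE_mono finite_PiE)
     (auto simp: w_nonneg)

lemma det_upto_tendsto: "(\<lambda>m. det_upto m N x) \<longlonglongrightarrow> det_kernel N x"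
  unfolding index_det_def by (intro tendsto_intros kernel_upto_tendsto)

text \<open>An increasing sequence stays below its limit. This makes \<open>det_kernel\<close> a
  common majorant for all truncations.\<close>

lemma det_upto_le: "det_upto m N x \<le> det_kernel N x"
  using det_upto_tendsto by (rule incseq_le[rotated]) (auto simp: incseq_def det_upto_mono)

lemma det_kernel_nonneg: "0 \<le> det_kernel N x"
  using det_upto_nonneg det_upto_le by (rule order_trans)

lemma measurable_det_kernel [measurable]:
  "det_kernel N \<in> borel_measurable (Pi\<^sub>M {..<N} (\<lambda>_. lborel))"
  by (rule borel_measurable_LIMSEQ_real[OF det_upto_tendsto measurable_det_upto])

section \<open>Integrals of truncated determinants against product functions\<close>

context
  fixes h :: "real \<Rightarrow> real" and C :: real
  assumes measurable_h [measurable]: "h \<in> borel_measurable borel"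
    and bound_h: "\<And>x. \<bar>h x\<bar> \<le> C"
begin

lemma bound_nonneg: "0 \<le> C"
  using bound_h[of 0] by simp

lemma integrable_gram: "integrable lborel (\<lambda>x. h x * (\<psi> i x * \<psi> j x))"
proof (rule Bochner_Integration.integrable_bound)
  show "integrable lborel (\<lambda>x. C * (\<psi> i x * \<psi> j x))"
    by (intro integrable_mult_right integrable_psi)
  show "AE x in lborel. norm (h x * (\<psi> i x * \<psi> j x)) \<le> norm (C * (\<psi> i x * \<psi> j x))"
    using bound_h bound_nonneg by (auto simp: abs_mult intro!: mult_right_mono)
qed measurable

lemma measurable_prod_h [measurable]:
  "(\<lambda>x. \<Prod>i<N. h (x i)) \<in> borel_measurable (Pi\<^sub>M {..<N} (\<lambda>_. lborel))"
  by (intro borel_measurable_prod)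
    (auto intro!: measurable_compose[OF measurable_component_singleton] simp: measurable_lborel1)

lemma prod_h_le: "\<bar>\<Prod>i<N. h (x i)\<bar> \<le> C ^ N"
  using prod_mono[of "{..<N}" "\<lambda>i. \<bar>h (x i)\<bar>" "\<lambda>_. C"] bound_h by (simp add: abs_prod)

text \<open>Andreief's identity: once the integrand is a finite sum of products of one-variable
  functions, Fubini factors every integral into entries of the Gram matrix.\<close>

lemma has_bochner_integral_det_upto:
  "has_bochner_integral (Pi\<^sub>M {..<N} (\<lambda>_. lborel)) (\<lambda>x. (\<Prod>i<N. h (x i)) * det_upto m N x)
     (\<Sum>f\<in>{..<N} \<rightarrow>\<^sub>E {..<m}. index_det {..<N} (\<lambda>i j. w (f i) * gram h (f i) (f j)))"
proof -
  interpret product_sigma_finite "\<lambda>_::nat. lborel :: real measure" ..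
  have "has_bochner_integral (Pi\<^sub>M {..<N} (\<lambda>_. lborel))
      (\<lambda>x. \<Sum>f\<in>{..<N} \<rightarrow>\<^sub>E {..<m}. (\<Prod>i<N. w (f i)) * (\<Sum>p | p permutes {..<N}. of_int (sign p) *
         (\<Prod>i<N. h (x i) * (\<psi> (f i) (x i) * \<psi> (f (p i)) (x i)))))
      (\<Sum>f\<in>{..<N} \<rightarrow>\<^sub>E {..<m}. (\<Prod>i<N. w (f i)) * (\<Sum>p | p permutes {..<N}. of_int (sign p) *
         (\<Prod>i<N. gram h (f i) (f (p i)))))"
  proof (intro has_bochner_integral_sum has_bochner_integral_mult_right)
    fix f p :: "nat \<Rightarrow> nat"
    let ?F = "\<lambda>i x. h x * (\<psi> (f i) x * \<psi> (f (p i)) x)"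
    show "has_bochner_integral (Pi\<^sub>M {..<N} (\<lambda>_. lborel)) (\<lambda>x. \<Prod>i<N. ?F i (x i))
        (\<Prod>i<N. gram h (f i) (f (p i)))"
      using product_integrable_prod[of "{..<N}" ?F] product_integral_prod[of "{..<N}" ?F] integrable_gram
      by (simp add: has_bochner_integral_iff gram_def)
  qed
  \<comment> \<open>Transposing the inner determinant collects everything that depends on the
    coordinate \<open>x i\<close> in the factor with index \<open>i\<close>.\<close>
  moreover have "(\<Prod>i<N. h (x i)) * det_upto m N x = (\<Sum>f\<in>{..<N} \<rightarrow>\<^sub>E {..<m}. (\<Prod>i<N. w (f i)) *
      (\<Sum>p | p permutes {..<N}. of_int (sign p) *
         (\<Prod>i<N. h (x i) * (\<psi> (f i) (x i) * \<psi> (f (p i)) (x i)))))" for x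
  proof -
    have "(\<Prod>i<N. h (x i)) * det_upto m N x = (\<Sum>f\<in>{..<N} \<rightarrow>\<^sub>E {..<m}.
        (\<Prod>i<N. h (x i)) * ((\<Prod>i<N. w (f i)) * ((\<Prod>i<N. \<psi> (f i) (x i)) *
          index_det {..<N} (\<lambda>i j. \<psi> (f j) (x i)))))"
      by (simp add: det_upto_expand sum_distrib_left index_det_transpose[of _ "\<lambda>i j. \<psi> (_ i) (x j)"])
    then show ?thesis
      by (simp add: index_det_def sum_distrib_left prod.distrib mult_ac)
  qed
  ultimately show ?thesis
    by (simp add: index_det_scale_rows) (simp add: index_det_def)
qed

end

text \<open>For \<open>h = 1\<close> the Gram matrix is the identity, so an injective
  \<open>f\<close> contributes the product of its weights and any other \<open>f\<close> contributes
  0. Summing the products over all maps gives the power of a partial sum of \<open>w\<close>, a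
  bound uniform in \<open>m\<close>.\<close>

lemma integral_det_upto_le:
  "integrable (Pi\<^sub>M {..<N} (\<lambda>_. lborel)) (det_upto m N)"
  "(\<integral>x. det_upto m N x \<partial>Pi\<^sub>M {..<N} (\<lambda>_. lborel)) \<le> suminf w ^ N"
proof -
  have gram: "gram (\<lambda>_. 1) i j = (if i = j then 1 else 0)" for i j
    by (simp add: gram_def orthonormal)
  have int: "has_bochner_integral (Pi\<^sub>M {..<N} (\<lambda>_. lborel)) (det_upto m N)
      (\<Sum>f\<in>{..<N} \<rightarrow>\<^sub>E {..<m}. index_det {..<N} (\<lambda>i j. w (f i) * gram (\<lambda>_. 1) (f i) (f j)))"
    using has_bochner_integral_det_upto[of "\<lambda>_. 1" 1, where N = N and m = m] by simp
  then show "integrable (Pi\<^sub>M {..<N} (\<lambda>_. lborel)) (det_upto m N)"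
    by (rule has_bochner_integral_iff[THEN iffD1, THEN conjunct1])
  have le: "index_det {..<N} (\<lambda>i j. w (f i) * gram (\<lambda>_. 1) (f i) (f j)) \<le> (\<Prod>i<N. w (f i))" for f
  proof (cases "inj_on f {..<N}")
    case True
    then have "index_det {..<N} (\<lambda>i j. w (f i) * gram (\<lambda>_. 1) (f i) (f j)) = (\<Prod>i<N. w (f i))"
      by (subst index_det_diag) (auto simp: gram inj_on_def)
    then show ?thesis by simp
  next
    case False
    then obtain i k where "i \<in> {..<N}" "k \<in> {..<N}" "i \<noteq> k" "f i = f k"
      by (auto simp: inj_on_def)
    then have "index_det {..<N} (\<lambda>i j. w (f i) * gram (\<lambda>_. 1) (f i) (f j)) = 0"
      by (intro index_det_equal_rows[of _ i k]) auto
    then show ?thesis by (simp add: prod_nonneg w_nonneg)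
  qed
  have "(\<integral>x. det_upto m N x \<partial>Pi\<^sub>M {..<N} (\<lambda>_. lborel)) \<le> (\<Sum>f\<in>{..<N} \<rightarrow>\<^sub>E {..<m}. \<Prod>i<N. w (f i))"
    unfolding has_bochner_integral_integral_eq[OF int] by (intro sum_mono le)
  also have "\<dots> = (\<Sum>n<m. w n) ^ N"
    using prod_sum_PiE[of "{..<N}" "\<lambda>_. {..<m}" "\<lambda>_. w"] by simp
  also have "\<dots> \<le> suminf w ^ N"
    by (intro power_mono sum_le_suminf summable_w sum_nonneg) (auto simp: w_nonneg)
  finally show "(\<integral>x. det_upto m N x \<partial>Pi\<^sub>M {..<N} (\<lambda>_. lborel)) \<le> suminf w ^ N" .
qed

text \<open>Monotone convergence in \<open>m\<close>, with the uniform bound of the truncated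
  integrals surviving in the limit.\<close>

lemma integral_det_kernel_le:
  "integrable (Pi\<^sub>M {..<N} (\<lambda>_. lborel)) (det_kernel N)"
  "(\<integral>x. det_kernel N x \<partial>Pi\<^sub>M {..<N} (\<lambda>_. lborel)) \<le> suminf w ^ N"
proof -
  let ?I = "\<lambda>m. \<integral>x. det_upto m N x \<partial>Pi\<^sub>M {..<N} (\<lambda>_. lborel)"
  have mono: "incseq ?I"
    by (auto simp: incseq_def intro!: integral_mono integral_det_upto_le det_upto_mono)
  obtain L where L: "?I \<longlonglongrightarrow> L"
    by (rule incseq_convergent[OF mono, of "suminf w ^ N"]) (use integral_det_upto_le in auto)
  note mc = integral_monotone_convergence_nonneg[OF integral_det_upto_le(1) _ _ _ L]
  show "integrable (Pi\<^sub>M {..<N} (\<lambda>_. lborel)) (det_kernel N)"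
    by (rule mc) (auto simp: mono_def det_upto_mono det_upto_nonneg det_upto_tendsto)
  have "(\<integral>x. det_kernel N x \<partial>Pi\<^sub>M {..<N} (\<lambda>_. lborel)) = L"
    by (rule mc) (auto simp: mono_def det_upto_mono det_upto_nonneg det_upto_tendsto)
  also have "L \<le> suminf w ^ N"
    using L integral_det_upto_le(2) by (intro LIMSEQ_le_const2) auto
  finally show "(\<integral>x. det_kernel N x \<partial>Pi\<^sub>M {..<N} (\<lambda>_. lborel)) \<le> suminf w ^ N" .
qed

text \<open>Two limits are exchanged. For fixed \<open>N\<close>, dominated convergence uses the
  majorant \<open>C ^ N * det_kernel N x\<close>; in the sum over \<open>N\<close>, Tannery's
  theorem uses the exponential series of \<open>C * suminf w\<close>. For fixed \<open>m\<close> the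
  series terminates and is a finite determinant.\<close>

theorem fredholm_expansion:
  assumes h [measurable]: "h \<in> borel_measurable borel" and C: "\<And>x. \<bar>h x\<bar> \<le> C"
  defines "D \<equiv> \<lambda>N. \<integral>x. (\<Prod>i<N. h (x i)) * det_kernel N x \<partial>Pi\<^sub>M {..<N} (\<lambda>_. lborel)"
  shows "integrable (Pi\<^sub>M {..<N} (\<lambda>_. lborel)) (\<lambda>x. (\<Prod>i<N. h (x i)) * det_kernel N x)"
    and "summable (\<lambda>N. 1 / fact N * D N)"
    and "(\<lambda>m. index_det {..<m} (\<lambda>i j. (if i = j then 1 else 0) + w i * gram h i j))
           \<longlonglongrightarrow> (\<Sum>N. 1 / fact N * D N)"
proof -
  note [measurable] = measurable_prod_h[OF h]
  have C0: "0 \<le> C" using C[of 0] by simp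
  have dominated: "norm ((\<Prod>i<N. h (x i)) * d) \<le> C ^ N * d'" if "0 \<le> d" "d \<le> d'" for N x d d'
    using prod_h_le[OF h C, where N = N and x = x] that C0 by (auto simp: abs_mult intro!: mult_mono)
  have bound: "integrable (Pi\<^sub>M {..<N} (\<lambda>_. lborel)) (\<lambda>x. C ^ N * det_kernel N x)" for N
    by (intro integrable_mult_right integral_det_kernel_le)
  show "integrable (Pi\<^sub>M {..<N} (\<lambda>_. lborel)) (\<lambda>x. (\<Prod>i<N. h (x i)) * det_kernel N x)"
  proof (rule Bochner_Integration.integrable_bound[OF bound])
    have "norm ((\<Prod>i<N. h (x i)) * det_kernel N x) \<le> norm (C ^ N * det_kernel N x)" for x
      using dominated[OF det_kernel_nonneg[of N x] order_refl] by (rule order_trans) simp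
    then show "AE x in Pi\<^sub>M {..<N} (\<lambda>_. lborel).
        norm ((\<Prod>i<N. h (x i)) * det_kernel N x) \<le> norm (C ^ N * det_kernel N x)"
      by (intro AE_I2)
  qed measurable
  define Dm where "Dm m N = (\<integral>x. (\<Prod>i<N. h (x i)) * det_upto m N x \<partial>Pi\<^sub>M {..<N} (\<lambda>_. lborel))" for m N
  have lim: "(\<lambda>m. 1 / fact N * Dm m N) \<longlonglongrightarrow> 1 / fact N * D N" for N
    unfolding D_def Dm_def
  proof (intro tendsto_mult_left integral_dominated_convergence[OF _ _ bound])
    show "AE x in Pi\<^sub>M {..<N} (\<lambda>_. lborel).
        norm ((\<Prod>i<N. h (x i)) * det_upto m N x) \<le> C ^ N * det_kernel N x" for m
      by (intro AE_I2 dominated det_upto_nonneg det_upto_le)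
    show "AE x in Pi\<^sub>M {..<N} (\<lambda>_. lborel).
        (\<lambda>m. (\<Prod>i<N. h (x i)) * det_upto m N x) \<longlonglongrightarrow> (\<Prod>i<N. h (x i)) * det_kernel N x"
      by (intro AE_I2 tendsto_mult_left det_upto_tendsto)
  qed measurable
  have bnd: "norm (1 / fact N * Dm m N) \<le> (C * suminf w) ^ N / fact N" for m N
  proof -
    have "\<bar>Dm m N\<bar> \<le> (\<integral>x. C ^ N * det_kernel N x \<partial>Pi\<^sub>M {..<N} (\<lambda>_. lborel))"
      unfolding Dm_def
      by (rule integral_abs_bound[THEN order_trans], rule integral_mono)
         (use has_bochner_integral_det_upto[OF h C, where N = N and m = m] bound dominated[OF det_upto_nonneg det_upto_le] in
           \<open>auto simp: has_bochner_integral_iff\<close>)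
    also have "\<dots> \<le> C ^ N * suminf w ^ N"
      using integral_det_kernel_le(2)[of N] C0 by (simp add: mult_left_mono)
    finally show ?thesis
      by (simp add: power_mult_distrib divide_right_mono)
  qed
  have "summable (\<lambda>N. norm (1 / fact N * D N)) \<and>
      (\<lambda>m. \<Sum>N. 1 / fact N * Dm m N) \<longlonglongrightarrow> (\<Sum>N. 1 / fact N * D N)"
  proof -
    have "eventually (\<lambda>(N, m). norm (1 / fact N * Dm m N) \<le> (C * suminf w) ^ N / fact N) (at_top \<times>\<^sub>F at_top)"
      by (intro always_eventually allI) (simp only: split_beta bnd)
    moreover have "summable (\<lambda>N. (C * suminf w) ^ N / fact N)"
      using summable_exp[of "C * suminf w"] by (simp add: divide_inverse_commute)
    ultimately show ?thesis
      using tannerys_theorem[of "\<lambda>N m. 1 / fact N * Dm m N" "\<lambda>N. 1 / fact N * D N", OF lim] by simp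
  qed
  moreover have "(\<Sum>N. 1 / fact N * Dm m N) = index_det {..<m} (\<lambda>i j. (if i = j then 1 else 0) + w i * gram h i j)" for m
  proof -
    have Dm: "Dm m N = (\<Sum>f\<in>{..<N} \<rightarrow>\<^sub>E {..<m}. index_det {..<N} (\<lambda>i j. w (f i) * gram h (f i) (f j)))" for N
      unfolding Dm_def by (rule has_bochner_integral_integral_eq[OF has_bochner_integral_det_upto[OF h C]])
    \<comment> \<open>There are no \<open>N\<close>-element subsets of an \<open>m\<close>-element
      set for \<open>N > m\<close>, so the truncated series stops at \<open>m\<close>.\<close>
    have "Dm m N = 0" if "N \<notin> {..m}" for N
    proof -
      have "{S. S \<subseteq> {..<m} \<and> card S = N} = {}"
        using that card_mono[of "{..<m}"] by fastforce
      then show ?thesis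
        unfolding Dm sum_index_det_PiE[OF finite_lessThan, where N = N and A = "\<lambda>i j. w i * gram h i j"]
        by (simp only: sum.empty mult_zero_right)
    qed
    then have "(\<Sum>N. 1 / fact N * Dm m N) = (\<Sum>N\<le>m. 1 / fact N * Dm m N)"
      by (intro suminf_finite) auto
    then show ?thesis
      unfolding Dm using sum_sum_index_det_PiE[of "{..<m}" m "\<lambda>i j. w i * gram h i j"] by simp
  qed
  ultimately show "summable (\<lambda>N. 1 / fact N * D N)"
    "(\<lambda>m. index_det {..<m} (\<lambda>i j. (if i = j then 1 else 0) + w i * gram h i j))
           \<longlonglongrightarrow> (\<Sum>N. 1 / fact N * D N)"
    using summable_norm_cancel[of "\<lambda>N. 1 / fact N * D N"] by auto
qed

end

section \<open>Hermite polynomials and Mehler's formula\<close>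

text \<open>The recursion comes from differentiating the polynomial times
  \<open>exp (- x\<^sup>2)\<close>, with the sign of the Rodrigues formula absorbed.\<close>

fun hermite_poly :: "nat \<Rightarrow> real poly" where
  "hermite_poly 0 = 1"
| "hermite_poly (Suc n) = [:0, 2:] * hermite_poly n - pderiv (hermite_poly n)"

lemma funpow_deriv_gaussian:
  "(deriv ^^ n) (\<lambda>y. exp (- y\<^sup>2)) = (\<lambda>x::real. (-1) ^ n * poly (hermite_poly n) x * exp (- x\<^sup>2))"
proof (induction n)
  case (Suc n)
  have "((\<lambda>x. (-1) ^ n * poly (hermite_poly n) x * exp (- x\<^sup>2)) has_field_derivative
      (-1) ^ Suc n * poly (hermite_poly (Suc n)) x * exp (- x\<^sup>2)) (at x)" for x :: real
    by (auto intro!: derivative_eq_intros poly_DERIV simp: algebra_simps)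
  then show ?case
    by (simp only: funpow.simps o_apply Suc.IH) (intro ext DERIV_imp_deriv)
qed simp

lemma hermite_eq_poly: "hermite n x = poly (hermite_poly n) x"
proof -
  have "(-1) ^ n * (-1) ^ n = (1::real)"
    by (simp flip: power_add)
  then show ?thesis
    unfolding hermite_def funpow_deriv_gaussian by (simp add: exp_minus field_simps)
qed

text \<open>Differentiating the recursion and inserting the induction hypothesis reassembles the
  recursion one degree lower. It is what turns the defining recursion into the three-term
  one.\<close>

lemma pderiv_hermite_poly: "pderiv (hermite_poly (Suc n)) = Polynomial.smult (2 * real (Suc n)) (hermite_poly n)"
proof (induction n)
  case (Suc n)
  have "pderiv (hermite_poly (Suc (Suc n))) =
      [:0, 2:] * pderiv (hermite_poly (Suc n)) + Polynomial.smult 2 (hermite_poly (Suc n)) -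
      pderiv (pderiv (hermite_poly (Suc n)))"
    by (subst hermite_poly.simps(2)) (simp add: pderiv_diff pderiv_mult pderiv_pCons pderiv_smult del: hermite_poly.simps)
  also have "\<dots> = Polynomial.smult (2 * real (Suc n)) ([:0, 2:] * hermite_poly n - pderiv (hermite_poly n)) +
      Polynomial.smult 2 (hermite_poly (Suc n))"
    unfolding Suc.IH by (simp add: pderiv_smult smult_diff_right del: hermite_poly.simps)
  also have "\<dots> = Polynomial.smult (2 * real (Suc (Suc n))) (hermite_poly (Suc n))"
    unfolding hermite_poly.simps(2)[symmetric] smult_add_left[symmetric]
    by (rule arg_cong2[of _ _ _ _ Polynomial.smult]) simp_all
  finally show ?case .
qed (simp add: pderiv_pCons)

lemma hermite_0 [simp]: "hermite 0 x = 1"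
  by (simp add: hermite_eq_poly)

lemma hermite_1 [simp]: "hermite (Suc 0) x = 2 * x"
  by (simp add: hermite_eq_poly)

lemma hermite_Suc_Suc:
  "hermite (Suc (Suc n)) x = 2 * x * hermite (Suc n) x - 2 * real (Suc n) * hermite n x"
  unfolding hermite_eq_poly
  by (subst hermite_poly.simps(2), subst pderiv_hermite_poly) (simp del: hermite_poly.simps)

section \<open>Orthogonality of the Hermite polynomials for the Gaussian weight\<close>

lemma gaussian_moment:
  "has_bochner_integral lborel (\<lambda>x. exp (- x\<^sup>2) * x ^ k)
     (if even k then sqrt pi * fact k / (2 ^ k * fact (k div 2)) else 0 :: real)"
proof (cases "even k")
  case True
  then obtain j where "k = 2 * j" by blast
  then show ?thesis
    using has_bochner_integral_even_function[OF gaussian_moment_even_pos[of j]] by simp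
next
  case False
  then obtain j where "k = 2 * j + 1" by (blast elim: oddE)
  then show ?thesis
    using has_bochner_integral_odd_function[OF gaussian_moment_odd_pos[of j]] by simp
qed

definition gaussian_functional :: "real poly \<Rightarrow> real" where
  "gaussian_functional p = (\<integral>x. exp (- x\<^sup>2) * poly p x \<partial>lborel)"

lemma integrable_gaussian_poly: "integrable lborel (\<lambda>x. exp (- x\<^sup>2) * poly p x :: real)"
proof -
  have "integrable lborel (\<lambda>x. \<Sum>i\<le>Polynomial.degree p. Polynomial.coeff p i * (exp (- x\<^sup>2) * x ^ i))"
    using gaussian_moment by (intro Bochner_Integration.integrable_sum integrable_mult_right)
      (auto simp: has_bochner_integral_iff)
  then show ?thesis
    by (simp add: poly_altdef sum_distrib_left mult_ac)
qed

lemma gaussian_functional_add: "gaussian_functional (p + q) = gaussian_functional p + gaussian_functional q"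
  unfolding gaussian_functional_def
  by (simp add: distrib_left Bochner_Integration.integral_add integrable_gaussian_poly)

lemma gaussian_functional_smult: "gaussian_functional (Polynomial.smult c p) = c * gaussian_functional p"
  unfolding gaussian_functional_def
  by (simp add: mult.left_commute[of _ c])

lemma gaussian_functional_diff: "gaussian_functional (p - q) = gaussian_functional p - gaussian_functional q"
  using gaussian_functional_add[of "p - q" q] by simp

lemma gaussian_functional_monom:
  "gaussian_functional (Polynomial.monom 1 k) = (if even k then sqrt pi * fact k / (2 ^ k * fact (k div 2)) else 0)"
  unfolding gaussian_functional_def
  using has_bochner_integral_integral_eq[OF gaussian_moment[of k]] by (simp add: poly_monom)

text \<open>This is integration by parts against the Gaussian, obtained from the explicit moments on
  monomials and extended by linearity.\<close>

lemma gaussian_functional_pderiv: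
  "gaussian_functional (pderiv p) = gaussian_functional ([:0, 2:] * p)"
proof -
  have x: "[:0, 2:] * q = Polynomial.smult 2 (Polynomial.monom 1 1 * q)" for q :: "real poly"
    by (simp add: monom_altdef)
  have monom: "gaussian_functional (pderiv (Polynomial.monom 1 k)) = gaussian_functional ([:0, 2:] * Polynomial.monom 1 k)" for k
  proof -
    \<comment> \<open>At \<open>k = 0\<close> the truncated \<open>k - 1\<close> is harmless: its
      coefficient is 0, and the first moment on the right vanishes by oddness.\<close>
    have "real k * gaussian_functional (Polynomial.monom 1 (k - 1)) = 2 * gaussian_functional (Polynomial.monom 1 (Suc k))"
    proof (cases k)
      case (Suc j)
      show ?thesis
      proof (cases "even j")
        case True
        then obtain i where "j = 2 * i" by blast
        then show ?thesis
          using Suc by (simp add: gaussian_functional_monom divide_simps) 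
      qed (use Suc in \<open>simp add: gaussian_functional_monom\<close>)
    qed (simp add: gaussian_functional_monom)
    moreover have "pderiv (Polynomial.monom 1 k) = Polynomial.smult (real k) (Polynomial.monom (1::real) (k - 1))"
      by (simp add: pderiv_monom smult_monom)
    ultimately show ?thesis
      unfolding x by (simp add: gaussian_functional_smult mult_monom)
  qed
  define P where "P q \<longleftrightarrow> gaussian_functional (pderiv q) = gaussian_functional ([:0, 2:] * q)" for q
  have add: "P (q + r)" if "P q" "P r" for q r
    using that unfolding P_def by (simp only: pderiv_add distrib_left gaussian_functional_add)
  have "P (Polynomial.monom c k)" for c k
  proof -
    have "Polynomial.monom c k = Polynomial.smult c (Polynomial.monom 1 k)" by (simp add: smult_monom)
    then show ?thesis
      using monom[of k] unfolding P_def by (simp only: pderiv_smult mult_smult_right gaussian_functional_smult)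
  qed
  then have "P (\<Sum>i\<le>n. Polynomial.monom (Polynomial.coeff p i) i)" for n
    by (induction n) (auto simp: add)
  then have "P p"
    using poly_as_sum_of_monoms[of p] by metis
  then show ?thesis by (simp only: P_def)
qed

text \<open>Under the Gaussian functional, multiplication by 2x minus differentiation is the adjoint
  of differentiation.\<close>

lemma gaussian_functional_hermite_Suc:
  "gaussian_functional (hermite_poly (Suc m) * q) = gaussian_functional (hermite_poly m * pderiv q)"
proof -
  have "gaussian_functional (hermite_poly (Suc m) * q) =
      gaussian_functional ([:0, 2:] * (hermite_poly m * q)) - gaussian_functional (pderiv (hermite_poly m) * q)"
    by (simp only: hermite_poly.simps left_diff_distrib gaussian_functional_diff mult.assoc)
  also have "gaussian_functional ([:0, 2:] * (hermite_poly m * q)) =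
      gaussian_functional (hermite_poly m * pderiv q) + gaussian_functional (pderiv (hermite_poly m) * q)"
    unfolding gaussian_functional_pderiv[symmetric] pderiv_mult gaussian_functional_add
    by (simp add: mult.commute)
  finally show ?thesis by simp
qed

text \<open>Each induction step moves one raising operator off the first factor; it becomes a
  derivative of the second, lowering its degree and producing a factor 2n. When the degrees differ,
  a constant is eventually differentiated.\<close>

lemma gaussian_functional_hermite:
  "gaussian_functional (hermite_poly m * hermite_poly n) = (if m = n then 2 ^ n * fact n * sqrt pi else 0)"
proof (induction m arbitrary: n)
  case 0
  have "gaussian_functional 1 = sqrt pi"
    using gaussian_functional_monom[of 0] by simp
  moreover have "gaussian_functional (hermite_poly (Suc k)) = 0" for k
    using gaussian_functional_hermite_Suc[of k 1] by (simp add: gaussian_functional_def del: hermite_poly.simps(2))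
  ultimately show ?case
    by (cases n) (auto simp del: hermite_poly.simps(2))
next
  case (Suc m)
  show ?case
  proof (cases n)
    case 0
    then show ?thesis
      using gaussian_functional_hermite_Suc[of m 1] by (simp add: gaussian_functional_def del: hermite_poly.simps(2))
  next
    case (Suc k)
    then show ?thesis
      using Suc.IH[of k]
      by (simp add: gaussian_functional_hermite_Suc pderiv_hermite_poly gaussian_functional_smult algebra_simps
          del: hermite_poly.simps(2))
  qed
qed

section \<open>Mehler's formula\<close>

definition mehler_coeff :: "real \<Rightarrow> real \<Rightarrow> nat \<Rightarrow> real" where
  "mehler_coeff x y n = hermite n x * hermite n y / (2 ^ n * fact n)"

text \<open>The coefficient of r^(m+3) in the differential equation for the generating function. The
  three-term recurrence expresses every Hermite value involved through those at \<open>m\<close> and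
  \<open>m + 1\<close>.\<close>

lemma mehler_coeff_recurrence:
  "real (m + 4) * mehler_coeff x y (m + 4) - 2 * real (m + 2) * mehler_coeff x y (m + 2) + real m * mehler_coeff x y m =
   2 * x * y * mehler_coeff x y (m + 3) + (1 - 2 * x\<^sup>2 - 2 * y\<^sup>2) * mehler_coeff x y (m + 2)
     + 2 * x * y * mehler_coeff x y (m + 1) - mehler_coeff x y m"
proof -
  define M where "M = real m"
  define D where "D = 2 ^ m * (fact m :: real)"
  have M: "M + 1 > 0" "M + 2 > 0" "M + 3 > 0" "M + 4 > 0" by (auto simp: M_def)
  have D: "D > 0" by (simp add: D_def)
  define u v u' v' where "u = hermite (Suc m) x" and "v = hermite m x"
    and "u' = hermite (Suc m) y" and "v' = hermite m y"
  define a b c where "a = 2 * x * u - 2 * (M + 1) * v" and "b = 2 * x * a - 2 * (M + 2) * u"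
    and "c = 2 * x * b - 2 * (M + 3) * a"
  define a' b' c' where "a' = 2 * y * u' - 2 * (M + 1) * v'" and "b' = 2 * y * a' - 2 * (M + 2) * u'"
    and "c' = 2 * y * b' - 2 * (M + 3) * a'"
  note h = hermite_Suc_Suc[of m] hermite_Suc_Suc[of "Suc m"] hermite_Suc_Suc[of "Suc (Suc m)"]
  have H: "hermite (m + 1) x = u" "hermite (m + 2) x = a" "hermite (m + 3) x = b" "hermite (m + 4) x = c"
    "hermite (m + 1) y = u'" "hermite (m + 2) y = a'" "hermite (m + 3) y = b'" "hermite (m + 4) y = c'"
    by (simp_all add: eval_nat_numeral h a_def b_def c_def a'_def b'_def c'_def u_def v_def u'_def v'_def M_def algebra_simps)
  have F: "2 ^ (m + 1) * fact (m + 1) = 2 * (M + 1) * D"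
    "2 ^ (m + 2) * fact (m + 2) = 4 * (M + 1) * (M + 2) * D"
    "2 ^ (m + 3) * fact (m + 3) = 8 * (M + 1) * (M + 2) * (M + 3) * D"
    "2 ^ (m + 4) * fact (m + 4) = 16 * (M + 1) * (M + 2) * (M + 3) * (M + 4) * D"
    by (simp_all add: eval_nat_numeral D_def M_def algebra_simps)
  \<comment> \<open>The claim cleared of the common denominator
    \<open>16 * (M + 1) * (M + 2) * (M + 3) * D\<close>: a polynomial identity in \<open>x\<close>,
    \<open>y\<close>, \<open>M\<close> and \<open>u\<close>, \<open>v\<close>, \<open>u'\<close>,
    \<open>v'\<close>.\<close>
  have key: "c * c' - 8 * (M + 2) * (M + 3) * (a * a') + 16 * M * (M + 1) * (M + 2) * (M + 3) * (v * v') =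
      4 * x * y * (b * b') + 4 * (M + 3) * (1 - 2 * x\<^sup>2 - 2 * y\<^sup>2) * (a * a')
      + 16 * x * y * (M + 2) * (M + 3) * (u * u') - 16 * (M + 1) * (M + 2) * (M + 3) * (v * v')"
    unfolding a_def b_def c_def a'_def b'_def c'_def by (simp add: power2_eq_square algebra_simps)
  define k where "k = 1 / (16 * (M + 1) * (M + 2) * (M + 3) * D)"
  have T: "(M + 4) * mehler_coeff x y (m + 4) = c * c' * k"
    "mehler_coeff x y (m + 3) = 2 * (b * b') * k"
    "mehler_coeff x y (m + 2) = 4 * (M + 3) * (a * a') * k"
    "mehler_coeff x y (m + 1) = 8 * (M + 2) * (M + 3) * (u * u') * k"
    "mehler_coeff x y m = 16 * (M + 1) * (M + 2) * (M + 3) * (v * v') * k"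
    unfolding mehler_coeff_def H F D_def[symmetric] v_def[symmetric] v'_def[symmetric] k_def
    using M D by (simp_all add: divide_simps) (auto simp: algebra_simps)
  have M_eq: "real (m + 4) = M + 4" "real (m + 2) = M + 2" "real m = M"
    by (simp_all add: M_def)
  show ?thesis
    unfolding M_eq T using arg_cong[OF key, of "\<lambda>z. z * k"] by (simp add: algebra_simps)
qed

text \<open>Each coefficient is bounded through its two predecessors, so the ratio test is applied
  to the maximum of two neighbours. Eventually this maximum grows by at most \<open>1 + d\<close>
  per step, and \<open>(1 + d) * r < 1\<close>.\<close>

lemma summable_mehler_coeff_diagonal:
  assumes r: "0 < r" "r < 1"
  shows "summable (\<lambda>n. mehler_coeff x x n * r ^ n)"
proof -
  define a where "a = mehler_coeff x x"
  have a_nonneg: "0 \<le> a n" for n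
    by (simp add: a_def mehler_coeff_def)
  define d where "d = (1 / r - 1) / 2"
  have d: "d > 0" "(1 + 2 * d) * r = 1" using r by (auto simp: d_def field_simps)
  define e where "e = d / 2"
  have e: "e > 0" using d by (simp add: e_def)
  define C where "C = (1 + 1 / e) * 2 * x\<^sup>2"
  have C: "C \<ge> 0" using e by (simp add: C_def)
  have step: "a (Suc (Suc n)) \<le> (1 + e) * a n + C / real (n + 2) * a (Suc n)" for n
  proof -
    define H where "H k = hermite k x" for k
    define D where "D = 2 ^ n * (fact n :: real)"
    have D: "D > 0" by (simp add: D_def)
    define N where "N = real n"
    have N: "N \<ge> 0" by (simp add: N_def)
    define A B where "A = 2 * x * H (Suc n)" and "B = 2 * (N + 1) * H n"
    \<comment> \<open>Young's inequality for the cross term of \<open>(A - B)\<^sup>2\<close>, with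
      nearly all the weight on \<open>B\<close>; the gap is exhibited as a multiple of a
      square.\<close>
    have "(1 + e) * B\<^sup>2 + (1 + 1 / e) * A\<^sup>2 - (A - B)\<^sup>2 = (A / e + B)\<^sup>2 * e"
      using e by (simp add: power2_eq_square field_simps)
    also have "\<dots> \<ge> 0" using e by simp
    finally have "(A - B)\<^sup>2 \<le> (1 + e) * B\<^sup>2 + (1 + 1 / e) * A\<^sup>2" by simp
    moreover have "H (Suc (Suc n)) = A - B"
      by (simp add: H_def hermite_Suc_Suc A_def B_def N_def)
    moreover have aa: "a (Suc (Suc n)) = (H (Suc (Suc n)))\<^sup>2 / (4 * (N + 1) * (N + 2) * D)"
      "a (Suc n) = (H (Suc n))\<^sup>2 / (2 * (N + 1) * D)" "a n = (H n)\<^sup>2 / D"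
      by (simp_all add: a_def mehler_coeff_def H_def D_def N_def power2_eq_square algebra_simps)
    ultimately have "a (Suc (Suc n)) \<le> ((1 + e) * B\<^sup>2 + (1 + 1 / e) * A\<^sup>2) / (4 * (N + 1) * (N + 2) * D)"
      using N D by (simp add: divide_right_mono)
    also have "\<dots> = (1 + e) * ((N + 1) / (N + 2)) * a n + C / (N + 2) * a (Suc n)"
      unfolding aa A_def B_def C_def using N D e
      by (simp add: add_divide_distrib power_mult_distrib) (simp add: divide_simps power2_eq_square, simp add: algebra_simps)
    also have "\<dots> \<le> (1 + e) * 1 * a n + C / (N + 2) * a (Suc n)"
      using N e by (intro add_right_mono mult_right_mono mult_left_mono a_nonneg) (auto simp: divide_simps)
    finally show ?thesis by (simp add: N_def add.commute)
  qed
  define E where "E n = max (a n) (a (Suc n))" for n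
  \<comment> \<open>From \<open>n0\<close> on, \<open>C / (n + 2)\<close> is at most
    \<open>e\<close>, and the two predecessors together give the factor
    \<open>1 + 2 * e = 1 + d\<close>.\<close>
  obtain n0 where n0: "C / e \<le> real n0" using real_arch_simple by blast
  have E_step: "E (Suc n) \<le> (1 + d) * E n" if "n \<ge> n0" for n
  proof -
    have "C / e \<le> real (n + 2)" using n0 that by simp
    then have "C / real (n + 2) \<le> e"
      using e by (simp add: divide_le_eq mult.commute)
    then have "a (Suc (Suc n)) \<le> (1 + e) * E n + e * E n"
      using step[of n] e a_nonneg C
      by (intro order_trans[OF step] add_mono mult_mono) (auto simp: E_def)
    also have "\<dots> = (1 + d) * E n" by (simp add: e_def algebra_simps)
    finally have "a (Suc (Suc n)) \<le> (1 + d) * E n" .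
    moreover have "E n \<ge> 0" using a_nonneg[of n] by (simp add: E_def le_max_iff_disj)
    then have "1 * E n \<le> (1 + d) * E n" using d by (intro mult_right_mono) auto
    then have "a (Suc n) \<le> (1 + d) * E n" by (simp add: E_def)
    ultimately show ?thesis by (simp add: E_def)
  qed
  have E_nonneg: "0 \<le> E n" for n using a_nonneg[of n] by (simp add: E_def le_max_iff_disj)
  have "summable (\<lambda>n. E n * r ^ n)"
  proof (rule summable_ratio_test)
    show "(1 + d) * r < 1" using d r mult_pos_pos[of d r] by (simp add: algebra_simps)
    show "norm (E (Suc n) * r ^ Suc n) \<le> (1 + d) * r * norm (E n * r ^ n)" if "n \<ge> n0" for n
      using mult_right_mono[OF E_step[OF that], of "r ^ Suc n"] r E_nonneg
      by (simp add: abs_mult mult_ac)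
  qed
  then show ?thesis
    unfolding a_def[symmetric]
    by (rule summable_comparison_test'[where N = 0])
      (use r a_nonneg in \<open>auto simp: E_def abs_mult intro!: mult_right_mono\<close>)
qed

lemma abs_mehler_coeff_le:
  "\<bar>mehler_coeff x y n\<bar> \<le> mehler_coeff x x n + mehler_coeff y y n"
proof -
  have "2 * (\<bar>hermite n x\<bar> * \<bar>hermite n y\<bar>) \<le> (hermite n x)\<^sup>2 + (hermite n y)\<^sup>2"
    using sum_squares_bound[of "\<bar>hermite n x\<bar>" "\<bar>hermite n y\<bar>"] by (simp add: mult.assoc)
  then have "\<bar>hermite n x\<bar> * \<bar>hermite n y\<bar> \<le> hermite n x * hermite n x + hermite n y * hermite n y"
    unfolding power2_eq_square
    using mult_nonneg_nonneg[OF abs_ge_zero[of "hermite n x"] abs_ge_zero[of "hermite n y"]] by linarith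
  then show ?thesis
    by (simp add: mehler_coeff_def abs_mult divide_right_mono flip: add_divide_distrib)
qed

lemma mehler_fps_conv_radius: "1 \<le> fps_conv_radius (Abs_fps (mehler_coeff x y))"
  unfolding fps_conv_radius_def
proof (rule conv_radius_geI_ex')
  fix r :: real assume r: "0 < r" "ereal r < 1"
  then have r: "0 < r" "r < 1" by auto
  show "summable (\<lambda>n. fps_nth (Abs_fps (mehler_coeff x y)) n * of_real r ^ n)"
  proof (rule summable_comparison_test')
    show "summable (\<lambda>n. mehler_coeff x x n * r ^ n + mehler_coeff y y n * r ^ n)"
      by (intro summable_add summable_mehler_coeff_diagonal r)
    show "norm (fps_nth (Abs_fps (mehler_coeff x y)) n * of_real r ^ n)
        \<le> mehler_coeff x x n * r ^ n + mehler_coeff y y n * r ^ n" for n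
      using mult_right_mono[OF abs_mehler_coeff_le[of x y n], of "r ^ n"] r
      by (simp add: abs_mult distrib_right)
  qed
qed

text \<open>The left side is (1 - X^2)^2 f' multiplied out. Coefficients of order at least 3 are the
  recurrence; the three lower ones are computed from the first Hermite polynomials.\<close>

lemma mehler_fps_ODE:
  fixes x y :: real
  defines "f \<equiv> Abs_fps (mehler_coeff x y)"
  shows "fps_deriv f - 2 * (fps_X ^ 2 * fps_deriv f) + fps_X ^ 4 * fps_deriv f =
    fps_const (2 * x * y) * f + fps_const (1 - 2 * x\<^sup>2 - 2 * y\<^sup>2) * (fps_X * f)
      + fps_const (2 * x * y) * (fps_X ^ 2 * f) - fps_X ^ 3 * f"
proof (rule fps_ext)
  fix n :: nat
  have num: "2 * g = fps_const 2 * g" for g :: "real fps" by (simp add: numeral_fps_const)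
  have "n = 0 \<or> n = 1 \<or> n = 2 \<or> n = (n - 3) + 3" by arith
  then consider "n = 0" | "n = 1" | "n = 2" | m where "n = m + 3" by blast
  then show "fps_nth (fps_deriv f - 2 * (fps_X ^ 2 * fps_deriv f) + fps_X ^ 4 * fps_deriv f) n =
    fps_nth (fps_const (2 * x * y) * f + fps_const (1 - 2 * x\<^sup>2 - 2 * y\<^sup>2) * (fps_X * f)
      + fps_const (2 * x * y) * (fps_X ^ 2 * f) - fps_X ^ 3 * f) n"
  proof cases
    case 4
    \<comment> \<open>For \<open>m = 0\<close> the shift by four leaves no coefficient at order 3,
      in agreement with the factor \<open>real m\<close>.\<close>
    have "fps_nth (fps_X ^ 4 * fps_deriv f) n = real m * mehler_coeff x y m"
      unfolding fps_X_power_mult_nth using 4 by (cases m) (auto simp: f_def)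
    then show ?thesis
      using mehler_coeff_recurrence[of m x y] unfolding num
      by (simp add: 4 fps_X_power_mult_nth fps_X_mult_nth f_def add.commute del: fps_const_mult fps_const_sub)
        (simp add: algebra_simps)
  qed (simp_all add: num fps_X_power_mult_nth fps_X_mult_nth f_def mehler_coeff_def hermite_Suc_Suc
        eval_nat_numeral algebra_simps add_divide_distrib diff_divide_distrib del: fps_const_mult fps_const_sub)
qed

text \<open>
  Both sides solve the first-order equation \<open>mehler_fps_ODE\<close> in \<open>r\<close>, with the same value at \<open>r = 0\<close>.
\<close>

theorem mehler_formula:
  fixes x y r :: real
  assumes r: "0 \<le> r" "r < 1"
  shows "(\<lambda>n. mehler_coeff x y n * r ^ n) sums
    (exp ((2 * x * y * r - (x\<^sup>2 + y\<^sup>2) * r\<^sup>2) / (1 - r\<^sup>2)) / sqrt (1 - r\<^sup>2))"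
proof -
  define f where "f = Abs_fps (mehler_coeff x y)"
  \<comment> \<open>Series with radius of convergence at least 1 are closed under the operations
    below, so evaluation respects these operations throughout |s| < 1.\<close>
  define good where "good g \<longleftrightarrow> 1 \<le> fps_conv_radius g" for g :: "real fps"
  have good_f: "good f"
    using mehler_fps_conv_radius by (simp add: good_def f_def)
  have good_mult: "good (g * h)" and good_add: "good (g + h)" and good_diff: "good (g - h)"
    if "good g" "good h" for g h
    using that fps_conv_radius_mult[of g h] fps_conv_radius_add[of g h] fps_conv_radius_diff[of g h]
    unfolding good_def by (metis min.bounded_iff order_trans)+
  have good_const: "good (fps_const c)" "good (fps_X ^ k)" "good fps_X" "good (numeral v)" for c k v
    by (auto simp: good_def)
  have good_deriv: "good (fps_deriv f)"
    using good_f fps_conv_radius_deriv[of f] unfolding good_def by (rule order_trans)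
  note good = good_mult good_add good_diff good_const good_f good_deriv
  have in_radius: "ereal \<bar>s\<bar> < fps_conv_radius g" if "good g" "\<bar>s\<bar> < 1" for g and s :: real
    using that unfolding good_def by (metis less_le_trans ereal_less(3))
  have ODE: "eval_fps (fps_deriv f) s * (1 - s\<^sup>2)\<^sup>2 =
      (2 * x * y + (1 - 2 * x\<^sup>2 - 2 * y\<^sup>2) * s + 2 * x * y * s\<^sup>2 - s ^ 3) * eval_fps f s"
    if s: "\<bar>s\<bar> < 1" for s
  proof -
    have "eval_fps (fps_deriv f - 2 * (fps_X ^ 2 * fps_deriv f) + fps_X ^ 4 * fps_deriv f) s =
        eval_fps (fps_deriv f) s * (1 - s\<^sup>2)\<^sup>2"
      by (simp add: eval_fps_add eval_fps_diff eval_fps_mult in_radius s good)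
        (simp add: power2_eq_square eval_nat_numeral algebra_simps)
    moreover have "eval_fps (fps_const (2 * x * y) * f + fps_const (1 - 2 * x\<^sup>2 - 2 * y\<^sup>2) * (fps_X * f)
        + fps_const (2 * x * y) * (fps_X ^ 2 * f) - fps_X ^ 3 * f) s =
        (2 * x * y + (1 - 2 * x\<^sup>2 - 2 * y\<^sup>2) * s + 2 * x * y * s\<^sup>2 - s ^ 3) * eval_fps f s"
      by (simp add: eval_fps_add eval_fps_diff eval_fps_mult in_radius s good del: fps_const_mult fps_const_sub)
        (simp add: algebra_simps)
    ultimately show ?thesis
      using mehler_fps_ODE[of x y] by (simp add: f_def)
  qed
  define e where "e s = (2 * x * y * s - (x\<^sup>2 + y\<^sup>2) * s\<^sup>2) / (1 - s\<^sup>2)" for s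
  \<comment> \<open>The quotient of the series by the claimed closed form. Its derivative vanishes
    by the differential equation, and its value at 0 is 1.\<close>
  define Q where "Q s = eval_fps f s * sqrt (1 - s\<^sup>2) * exp (- e s)" for s
  have Q': "(Q has_field_derivative 0) (at s within {0..<1})" if s: "s \<in> {0..<1}" for s
  proof -
    define p where "p = 1 - s\<^sup>2"
    have p: "p > 0"
      using s by (simp add: p_def power_less_one_iff abs_square_less_1)
    define F' where "F' = eval_fps (fps_deriv f) s"
    define e' where "e' = ((2 * x * y - 2 * (x\<^sup>2 + y\<^sup>2) * s) * p + 2 * s * (2 * x * y * s - (x\<^sup>2 + y\<^sup>2) * s\<^sup>2)) / p\<^sup>2"
    have F: "(eval_fps f has_field_derivative F') (at s within {0..<1})"
      unfolding F'_def using s in_radius[OF good_f, of s] by (intro has_field_derivative_eval_fps) auto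
    have e: "(e has_field_derivative e') (at s within {0..<1})"
      unfolding e_def e'_def p_def using p
      by (auto intro!: derivative_eq_intros simp: p_def power2_eq_square algebra_simps)
    have sq: "((\<lambda>s. sqrt (1 - s\<^sup>2)) has_field_derivative - s / sqrt p) (at s within {0..<1})"
      using p by (auto intro!: derivative_eq_intros simp: p_def field_simps)
    have ex: "((\<lambda>s. exp (- e s)) has_field_derivative exp (- e s) * - e') (at s within {0..<1})"
      by (auto intro!: derivative_eq_intros e)
    have "(Q has_field_derivative
        (F' * sqrt p - eval_fps f s * (s / sqrt p) - eval_fps f s * sqrt p * e') * exp (- e s))
        (at s within {0..<1})"
      unfolding Q_def
      by (rule DERIV_cong[OF DERIV_mult[OF DERIV_mult[OF F sq] ex]]) (simp add: p_def algebra_simps)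
    moreover have "F' * sqrt p - eval_fps f s * (s / sqrt p) - eval_fps f s * sqrt p * e' = 0"
    proof -
      have A: "p\<^sup>2 * e' = (2 * x * y - 2 * (x\<^sup>2 + y\<^sup>2) * s) * p + 2 * s * (2 * x * y * s - (x\<^sup>2 + y\<^sup>2) * s\<^sup>2)"
        using p by (simp add: e'_def)
      have B: "F' * p\<^sup>2 = (2 * x * y + (1 - 2 * x\<^sup>2 - 2 * y\<^sup>2) * s + 2 * x * y * s\<^sup>2 - s ^ 3) * eval_fps f s"
        unfolding F'_def p_def using s by (intro ODE) auto
      \<comment> \<open>The extra factor \<open>p\<close> clears the denominator of
        \<open>e'\<close> and produces the square in which the differential equation is
        stated.\<close>
      have "p * (F' * p - eval_fps f s * s - eval_fps f s * p * e') =
          F' * p\<^sup>2 - eval_fps f s * s * p - eval_fps f s * (p\<^sup>2 * e')"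
        by (simp add: power2_eq_square algebra_simps)
      also have "\<dots> = 0"
        unfolding A B unfolding p_def by (simp add: power2_eq_square power3_eq_cube algebra_simps)
      finally have "p * (F' * p - eval_fps f s * s - eval_fps f s * p * e') = 0" .
      then have "F' * p - eval_fps f s * s - eval_fps f s * p * e' = 0" using p by simp
      moreover have "F' * p - eval_fps f s * s - eval_fps f s * p * e' =
          sqrt p * (F' * sqrt p - eval_fps f s * (s / sqrt p) - eval_fps f s * sqrt p * e')"
        using p by (simp add: algebra_simps)
      ultimately show ?thesis using p by simp
    qed
    ultimately show ?thesis by simp
  qed
  have "\<exists>c. \<forall>s\<in>{0..<1}. Q s = c"
    by (rule has_field_derivative_zero_constant[OF _ Q']) auto
  then have "Q r = Q 0" using r by auto
  also have "Q 0 = 1"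
    by (simp add: Q_def e_def eval_fps_at_0 f_def mehler_coeff_def)
  finally have "eval_fps f r = exp (e r) / sqrt (1 - r\<^sup>2)"
    using r by (auto simp: Q_def exp_minus field_simps power2_eq_1_iff)
  moreover have "(\<lambda>n. fps_nth f n * r ^ n) sums eval_fps f r"
    using r in_radius[OF good_f, of r] by (intro sums_eval_fps) auto
  ultimately show ?thesis by (simp add: f_def e_def)
qed

section \<open>The rescaled Hermite functions and the one-particle kernel\<close>

definition hermite_norm :: "nat \<Rightarrow> real" where
  "hermite_norm n = pi powr (- 1 / 4) * (2 ^ n * fact n) powr (- 1 / 2)"

lemma hermite_norm_square: "hermite_norm n * hermite_norm n = 1 / (sqrt pi * (2 ^ n * fact n))"
proof -
  have "hermite_norm n * hermite_norm n =
      (pi powr (- 1 / 4) * pi powr (- 1 / 4)) * ((2 ^ n * fact n) powr (- 1 / 2) * (2 ^ n * fact n) powr (- 1 / 2))"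
    by (simp add: hermite_norm_def mult_ac)
  also have "\<dots> = pi powr - (1 / 2) * (2 ^ n * fact n) powr - 1"
    by (simp flip: powr_add)
  also have "\<dots> = 1 / (sqrt pi * (2 ^ n * fact n))"
    by (simp add: powr_minus powr_half_sqrt field_simps)
  finally show ?thesis .
qed

lemma mns_beta_pos: "0 < q \<Longrightarrow> q < 1 \<Longrightarrow> 0 < mns_beta q"
  by (simp add: mns_beta_def)

lemma mns_psi_mult:
  assumes q: "0 < q" "q < 1"
  shows "mns_psi q i x * mns_psi q j y =
    mns_beta q * (hermite_norm i * hermite_norm j) * (hermite i (mns_beta q * x) * hermite j (mns_beta q * y))
      * exp (- ((mns_beta q)\<^sup>2 * (x\<^sup>2 + y\<^sup>2)) / 2)"
proof -
  have "mns_psi q i x * mns_psi q j y = (sqrt (mns_beta q) * sqrt (mns_beta q)) *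
    (hermite_norm i * hermite_norm j) * (hermite i (mns_beta q * x) * hermite j (mns_beta q * y)) *
    (exp (- ((mns_beta q)\<^sup>2 * x\<^sup>2) / 2) * exp (- ((mns_beta q)\<^sup>2 * y\<^sup>2) / 2))"
    by (simp add: mns_psi_def normalized_hermite_def hermite_norm_def mult_ac)
  also have "exp (- ((mns_beta q)\<^sup>2 * x\<^sup>2) / 2) * exp (- ((mns_beta q)\<^sup>2 * y\<^sup>2) / 2) =
      exp (- ((mns_beta q)\<^sup>2 * (x\<^sup>2 + y\<^sup>2)) / 2)"
    by (simp add: algebra_simps add_divide_distrib flip: exp_add)
  finally show ?thesis
    using mns_beta_pos[OF q] by simp
qed

lemma measurable_mns_psi [measurable]: "mns_psi q n \<in> borel_measurable borel"
proof -
  have "poly p \<in> borel_measurable borel" for p :: "real poly"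
    by (intro borel_measurable_continuous_onI continuous_intros)
  then have "hermite n \<in> borel_measurable borel"
    by (simp add: hermite_eq_poly[abs_def])
  note [measurable] = this
  show ?thesis
    unfolding mns_psi_def normalized_hermite_def by measurable
qed

text \<open>The two factors \<open>sqrt (mns_beta q)\<close> supply the Jacobian of the rescaling,
  which reduces the claim to orthogonality of the Hermite polynomials.\<close>

lemma mns_psi_orthonormal:
  assumes q: "0 < q" "q < 1"
  shows "has_bochner_integral lborel (\<lambda>x. mns_psi q i x * mns_psi q j x) (if i = j then 1 else 0)"
proof -
  let ?\<beta> = "mns_beta q" and ?c = "hermite_norm i * hermite_norm j"
  let ?f = "\<lambda>x. exp (- x\<^sup>2) * poly (hermite_poly i * hermite_poly j) x"
  have \<beta>: "?\<beta> > 0" using q by (rule mns_beta_pos)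
  have psi: "mns_psi q i x * mns_psi q j x = ?\<beta> * ?c * ?f (0 + ?\<beta> * x)" for x
  proof -
    have "- (?\<beta>\<^sup>2 * (x\<^sup>2 + x\<^sup>2)) / 2 = - (?\<beta> * x)\<^sup>2"
      by (simp add: power_mult_distrib)
    then show ?thesis
      unfolding mns_psi_mult[OF q] by (simp add: hermite_eq_poly mult_ac)
  qed
  have "integrable lborel (\<lambda>x. ?f (0 + ?\<beta> * x))"
    using \<beta> by (intro lborel_integrable_real_affine integrable_gaussian_poly) auto
  moreover have "?\<beta> * ?c * (\<integral>x. ?f (0 + ?\<beta> * x) \<partial>lborel) = (if i = j then 1 else 0)"
  proof -
    have E: "?\<beta> * (\<integral>x. ?f (0 + ?\<beta> * x) \<partial>lborel) = gaussian_functional (hermite_poly i * hermite_poly j)"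
      unfolding gaussian_functional_def using \<beta> by (subst lborel_integral_real_affine[of ?\<beta> _ 0]) auto
    have "?\<beta> * ?c * (\<integral>x. ?f (0 + ?\<beta> * x) \<partial>lborel) = ?c * gaussian_functional (hermite_poly i * hermite_poly j)"
      unfolding E[symmetric] by (simp only: mult_ac)
    also have "\<dots> = (if i = j then 1 else 0)"
      by (simp add: gaussian_functional_hermite hermite_norm_square)
    finally show ?thesis .
  qed
  ultimately show ?thesis
    unfolding psi has_bochner_integral_iff by simp
qed

text \<open>Mehler's formula at \<open>mns_beta q * x\<close> and \<open>mns_beta q * y\<close> with
  expansion parameter \<open>q\<close>. The choice of \<open>mns_beta\<close> reduces the quadratic
  part to \<open>- (x\<^sup>2 + y\<^sup>2) / 2\<close>, and the relation between \<open>q\<close>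
  and \<open>t\<close> identifies both the interaction term and the prefactor.\<close>

lemma mns_phi_sums:
  assumes q: "0 < q" "q < 1" and t: "t > 0" and b: "1 / (2 * t) = q / (1 - q)\<^sup>2"
  shows "(\<lambda>n. q powr (real n + 1 / 2) * mns_psi q n x * mns_psi q n y) sums mns_phi t x y"
proof -
  define \<beta> where "\<beta> = mns_beta q"
  have \<beta>2: "\<beta>\<^sup>2 = (1 + q) / (1 - q)"
    using q by (simp add: \<beta>_def mns_beta_def)
  define c where "c = \<beta> * sqrt q / sqrt pi * exp (- (\<beta>\<^sup>2 * (x\<^sup>2 + y\<^sup>2)) / 2)"
  \<comment> \<open>In terms of \<open>d\<close> the denominators of the exponent become plain
    powers of one variable.\<close>
  define d where "d = 1 - q"
  have d: "d > 0" "d < 1" "q = 1 - d" using q by (auto simp: d_def)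
  have q2: "1 - q\<^sup>2 = (1 - q) * (1 + q)" by (simp add: power2_eq_square algebra_simps)
  have "q powr (real n + 1 / 2) * mns_psi q n x * mns_psi q n y =
      c * (mehler_coeff (\<beta> * x) (\<beta> * y) n * q ^ n)" for n
  proof -
    have "q powr (real n + 1 / 2) = q ^ n * sqrt q"
      using q by (simp add: powr_add powr_realpow powr_half_sqrt)
    then show ?thesis
      unfolding mult.assoc[of _ "mns_psi q n x"] mns_psi_mult[OF q] hermite_norm_square
      by (simp add: c_def \<beta>_def mehler_coeff_def)
  qed
  moreover have "(\<lambda>n. c * (mehler_coeff (\<beta> * x) (\<beta> * y) n * q ^ n)) sums
     (c * (exp ((2 * (\<beta> * x) * (\<beta> * y) * q - ((\<beta> * x)\<^sup>2 + (\<beta> * y)\<^sup>2) * q\<^sup>2) / (1 - q\<^sup>2)) / sqrt (1 - q\<^sup>2)))"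
    using q by (intro sums_mult mehler_formula) auto
  moreover have "c * (exp ((2 * (\<beta> * x) * (\<beta> * y) * q - ((\<beta> * x)\<^sup>2 + (\<beta> * y)\<^sup>2) * q\<^sup>2) / (1 - q\<^sup>2)) / sqrt (1 - q\<^sup>2)) =
      mns_phi t x y"
  proof -
    have "(2 * (\<beta> * x) * (\<beta> * y) * q - ((\<beta> * x)\<^sup>2 + (\<beta> * y)\<^sup>2) * q\<^sup>2) / (1 - q\<^sup>2) =
        \<beta>\<^sup>2 * (2 * x * y * q - (x\<^sup>2 + y\<^sup>2) * q\<^sup>2) / (1 - q\<^sup>2)"
      by (simp add: power2_eq_square algebra_simps)
    also have "\<dots> = (2 * x * y * q - (x\<^sup>2 + y\<^sup>2) * q\<^sup>2) / (1 - q)\<^sup>2"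
      unfolding \<beta>2 q2 using q by (simp add: power2_eq_square)
    finally have "- (\<beta>\<^sup>2 * (x\<^sup>2 + y\<^sup>2)) / 2 +
        (2 * (\<beta> * x) * (\<beta> * y) * q - ((\<beta> * x)\<^sup>2 + (\<beta> * y)\<^sup>2) * q\<^sup>2) / (1 - q\<^sup>2) =
        - ((1 + q) / (1 - q) * (x\<^sup>2 + y\<^sup>2)) / 2 + (2 * x * y * q - (x\<^sup>2 + y\<^sup>2) * q\<^sup>2) / (1 - q)\<^sup>2"
      by (simp add: \<beta>2)
    also have "\<dots> = - (x\<^sup>2 + y\<^sup>2) / 2 - (x - y)\<^sup>2 * (q / (1 - q)\<^sup>2)"
      unfolding d_def[symmetric] d(3) using d(1)
      by (simp add: divide_simps) (simp add: power2_eq_square algebra_simps)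
    also have "\<dots> = - (x\<^sup>2 + y\<^sup>2) / 2 - (x - y)\<^sup>2 / (2 * t)"
      unfolding b[symmetric] by simp
    finally have expo: "exp (- (\<beta>\<^sup>2 * (x\<^sup>2 + y\<^sup>2)) / 2) *
        exp ((2 * (\<beta> * x) * (\<beta> * y) * q - ((\<beta> * x)\<^sup>2 + (\<beta> * y)\<^sup>2) * q\<^sup>2) / (1 - q\<^sup>2)) =
        exp (- (x\<^sup>2 + y\<^sup>2) / 2 - (x - y)\<^sup>2 / (2 * t))"
      by (simp flip: exp_add)
    have "\<beta> * sqrt q / sqrt pi / sqrt (1 - q\<^sup>2) = sqrt ((1 + q) / (1 - q) * q / pi / ((1 - q) * (1 + q)))"
      unfolding q2 \<beta>_def mns_beta_def by (simp add: real_sqrt_mult real_sqrt_divide)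
    also have "(1 + q) / (1 - q) * q / pi / ((1 - q) * (1 + q)) = q / (1 - q)\<^sup>2 / pi"
      using q by (simp add: divide_simps power2_eq_square)
    also have "\<dots> = 1 / (2 * pi * t)"
      unfolding b[symmetric] by simp
    finally have pre: "\<beta> * sqrt q / sqrt pi / sqrt (1 - q\<^sup>2) = 1 / sqrt (2 * pi * t)"
      by (simp add: real_sqrt_divide)
    show ?thesis
      unfolding mns_phi_def pre[symmetric] expo[symmetric] c_def by simp
  qed
  ultimately show ?thesis by simp
qed

section \<open>Configurations and the grand canonical measure\<close>

lemma space_configuration_algebra: "space configuration_algebra = configurations"
  unfolding configuration_algebra_def by (subst space_measure_of) auto

lemma measurable_particle_count:
  assumes "A \<in> sets borel" "bounded A"
  shows "particle_count A \<in> measurable configuration_algebra (count_space UNIV)"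
proof -
  have "particle_count A -` {n} \<inter> configurations \<in> sets configuration_algebra" for n
  proof -
    have "particle_count A -` {n} \<inter> configurations = {c \<in> configurations. particle_count A c = n}"
      by auto
    also have "\<dots> \<in> sets configuration_algebra"
      unfolding configuration_algebra_def using assms by (subst sets_measure_of) auto
    finally show ?thesis .
  qed
  then show ?thesis
    by (simp add: measurable_count_space_eq_countable space_configuration_algebra)
qed

lemma finite_particles:
  assumes "c \<in> configurations" "compact K"
  shows "finite {x \<in> K. c x \<noteq> 0}"
  using assms by (simp add: configurations_def)

text \<open>Grouping the particles by the value of \<open>s\<close> gives a finite product of powers
  of counts. The level sets of nonzero values lie in \<open>K\<close>, hence are bounded and their
  counts measurable.\<close>

lemma measurable_particle_product_finite_range:
  assumes s: "s \<in> borel_measurable borel" "finite (range s)" and K: "compact K" "\<And>x. s x \<noteq> 0 \<Longrightarrow> x \<in> K"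
  shows "particle_product s \<in> borel_measurable configuration_algebra"
proof -
  let ?V = "range s - {0}"
  have "(\<lambda>c. \<Prod>y\<in>?V. (1 + y) ^ particle_count (s -` {y}) c) \<in> borel_measurable configuration_algebra"
  proof (rule borel_measurable_prod)
    fix y assume y: "y \<in> ?V"
    have "s -` {y} \<in> sets borel"
      using measurable_sets[OF s(1), of "{y}"] by simp
    moreover have "bounded (s -` {y})"
      using y K(2) by (intro bounded_subset[OF compact_imp_bounded[OF K(1)]]) auto
    ultimately show "(\<lambda>c. (1 + y) ^ particle_count (s -` {y}) c) \<in> borel_measurable configuration_algebra"
      by (intro measurable_compose[OF measurable_particle_count]) auto
  qed
  also have "(\<lambda>c. \<Prod>y\<in>?V. (1 + y) ^ particle_count (s -` {y}) c) \<in> borel_measurable configuration_algebra \<longleftrightarrow>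
      particle_product s \<in> borel_measurable configuration_algebra"
  proof (rule measurable_cong)
    fix c assume "c \<in> space configuration_algebra"
    then have c: "c \<in> configurations" by (simp add: space_configuration_algebra)
    let ?X = "{x. c x \<noteq> 0 \<and> s x \<noteq> 0}"
    have fin: "finite ?X"
      by (rule finite_subset[OF _ finite_particles[OF c K(1)]]) (use K(2) in auto)
    have "particle_product s c = (\<Prod>y\<in>?V. \<Prod>x | x \<in> ?X \<and> s x = y. (1 + s x) ^ c x)"
      unfolding particle_product_def using fin s(2) by (intro prod.group[symmetric]) auto
    also have "\<dots> = (\<Prod>y\<in>?V. (1 + y) ^ particle_count (s -` {y}) c)"
    proof (rule prod.cong[OF refl])
      fix y assume "y \<in> ?V"
      then have "{x. x \<in> ?X \<and> s x = y} = {x. x \<in> s -` {y} \<and> c x \<noteq> 0}" by auto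
      then show "(\<Prod>x | x \<in> ?X \<and> s x = y. (1 + s x) ^ c x) = (1 + y) ^ particle_count (s -` {y}) c"
        by (simp add: particle_count_def power_sum)
    qed
    finally show "(\<Prod>y\<in>?V. (1 + y) ^ particle_count (s -` {y}) c) = particle_product s c" ..
  qed
  finally show ?thesis .
qed

text \<open>Approximation by simple functions with |s_i| \<le> 2|g|: they vanish where
  \<open>g\<close> does, so for each configuration all products run over the same finite set of
  particles in \<open>K\<close> and converge factor by factor.\<close>

lemma measurable_particle_product:
  assumes g: "g \<in> borel_measurable borel" and K: "compact K" "\<And>x. g x \<noteq> 0 \<Longrightarrow> x \<in> K"
  shows "particle_product g \<in> borel_measurable configuration_algebra"
proof -
  obtain s where s: "\<And>i. simple_function borel (s i)" "\<And>x. (\<lambda>i. s i x) \<longlonglongrightarrow> g x"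
    "\<And>i x. norm (s i x) \<le> 2 * norm (g x)"
    using borel_measurable_implies_sequence_metric[OF g, of 0] by (auto simp: dist_norm)
  have zero: "s i x = 0" if "g x = 0" for i x
    using s(3)[of i x] that by simp
  show ?thesis
  proof (rule borel_measurable_LIMSEQ_metric)
    show "particle_product (s i) \<in> borel_measurable configuration_algebra" for i
      using s(1)[of i] K zero[of _ i]
      by (intro measurable_particle_product_finite_range[of _ K])
        (auto intro: borel_measurable_simple_function dest: simple_functionD(1))
    fix c assume "c \<in> space configuration_algebra"
    then have c: "c \<in> configurations" by (simp add: space_configuration_algebra)
    let ?X = "{x \<in> K. c x \<noteq> 0}"
    have fin: "finite ?X" by (rule finite_particles[OF c K(1)])
    have eq: "particle_product f c = (\<Prod>x\<in>?X. (1 + f x) ^ c x)" if "\<And>x. f x \<noteq> 0 \<Longrightarrow> x \<in> K" for f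
      unfolding particle_product_def using fin that by (intro prod.mono_neutral_left) auto
    have "(\<lambda>i. \<Prod>x\<in>?X. (1 + s i x) ^ c x) \<longlonglongrightarrow> (\<Prod>x\<in>?X. (1 + g x) ^ c x)"
      by (intro tendsto_intros s)
    moreover have "particle_product (s i) c = (\<Prod>x\<in>?X. (1 + s i x) ^ c x)" for i
      by (rule eq) (use zero K(2) in auto)
    moreover have "particle_product g c = (\<Prod>x\<in>?X. (1 + g x) ^ c x)"
      by (rule eq) (rule K(2))
    ultimately show "(\<lambda>i. particle_product (s i) c) \<longlonglongrightarrow> particle_product g c"
      by (simp only:)
  qed
qed

section \<open>Configurations of finitely many labelled points\<close>

lemma particle_product_configuration_of:
  "particle_product g (configuration_of N x) = (\<Prod>i<N. 1 + g (x i))"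
proof -
  let ?c = "configuration_of N x"
  have c0: "?c y \<noteq> 0 \<longleftrightarrow> y \<in> x ` {..<N}" for y
    by (auto simp: configuration_of_def card_eq_0_iff)
  have "(\<Prod>i<N. 1 + g (x i)) = (\<Prod>y\<in>x ` {..<N}. \<Prod>i | i \<in> {..<N} \<and> x i = y. 1 + g (x i))"
    by (rule prod.image_gen) simp
  also have "\<dots> = (\<Prod>y\<in>x ` {..<N}. (1 + g y) ^ ?c y)"
    by (intro prod.cong) (auto simp: configuration_of_def)
  also have "\<dots> = (\<Prod>y | ?c y \<noteq> 0 \<and> g y \<noteq> 0. (1 + g y) ^ ?c y)"
    \<comment> \<open>Occupied positions with \<open>g y = 0\<close> contribute the factor 1 and may
      be dropped.\<close>
    by (intro prod.mono_neutral_right) (auto simp: c0 simp del: neq0_conv)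
  finally show ?thesis by (simp add: particle_product_def)
qed

text \<open>Summing the multiplicities over the occupied positions in \<open>A\<close> counts the
  labels whose points lie in \<open>A\<close>; as a sum of indicators this is visibly measurable in
  the coordinates.\<close>

lemma particle_count_configuration_of:
  "real (particle_count A (configuration_of N x)) = (\<Sum>i<N. indicator A (x i))"
proof -
  let ?c = "configuration_of N x" and ?S = "{i. i < N \<and> x i \<in> A}"
  have "(\<Sum>i<N. indicator A (x i) :: real) = card ?S"
    by (simp add: indicator_def sum.If_cases Int_def)
  also have "card ?S = (\<Sum>i\<in>?S. 1)" by simp
  also have "\<dots> = (\<Sum>y\<in>x ` ?S. \<Sum>i | i \<in> ?S \<and> x i = y. 1)"
    by (rule sum.image_gen) simp
  also have "\<dots> = (\<Sum>y\<in>x ` ?S. ?c y)"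
    by (intro sum.cong) (auto simp: configuration_of_def intro!: arg_cong[of _ _ card])
  also have "x ` ?S = {y. y \<in> A \<and> ?c y \<noteq> 0}"
    by (auto simp: configuration_of_def card_eq_0_iff)
  finally show ?thesis by (simp add: particle_count_def)
qed

lemma configuration_of_in_configurations: "configuration_of N x \<in> configurations"
proof -
  have "finite {y. configuration_of N x y \<noteq> 0}"
    by (rule finite_subset[of _ "x ` {..<N}"]) (auto simp: configuration_of_def card_eq_0_iff)
  then show ?thesis by (auto simp: configurations_def intro: rev_finite_subset)
qed

lemma measurable_configuration_of [measurable]:
  "configuration_of N \<in> measurable (Pi\<^sub>M {..<N} (\<lambda>_. lborel)) configuration_algebra"
  unfolding configuration_algebra_def
proof (rule measurable_measure_of)
  show "configuration_of N \<in> space (Pi\<^sub>M {..<N} (\<lambda>_. lborel)) \<rightarrow> configurations"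
    by (simp add: configuration_of_in_configurations)
next
  fix B assume "B \<in> {{c \<in> configurations. particle_count A c = n} |A n. A \<in> sets borel \<and> bounded A}"
  then obtain A n where B: "B = {c \<in> configurations. particle_count A c = n}" and A [measurable]: "A \<in> sets borel"
    by auto
  have "configuration_of N -` B \<inter> space (Pi\<^sub>M {..<N} (\<lambda>_. lborel)) =
      {x \<in> space (Pi\<^sub>M {..<N} (\<lambda>_. lborel)). (\<Sum>i<N. indicator A (x i)) = real n}"
    unfolding particle_count_configuration_of[symmetric] B
    using configuration_of_in_configurations by auto
  also have "\<dots> \<in> sets (Pi\<^sub>M {..<N} (\<lambda>_. lborel))"
    by measurable
  finally show "configuration_of N -` B \<inter> space (Pi\<^sub>M {..<N} (\<lambda>_. lborel)) \<in> sets (Pi\<^sub>M {..<N} (\<lambda>_. lborel))" .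
qed auto

section \<open>Integration against mixtures\<close>

lemma integral_pos_part_minus_neg_part:
  fixes f :: "'a \<Rightarrow> real"
  assumes "integrable M f"
  shows "(\<integral>x. max 0 (f x) \<partial>M) - (\<integral>x. max 0 (- f x) \<partial>M) = (\<integral>x. f x \<partial>M)"
proof -
  have "(\<integral>x. max 0 (f x) \<partial>M) - (\<integral>x. max 0 (- f x) \<partial>M) = (\<integral>x. max 0 (f x) - max 0 (- f x) \<partial>M)"
    using assms by (intro Bochner_Integration.integral_diff[symmetric] integrable_max) auto
  also have "\<dots> = (\<integral>x. f x \<partial>M)"
    by (intro Bochner_Integration.integral_cong) auto
  finally show ?thesis .
qed

text \<open>The mixture identity is available for nonnegative functions only. Absolute summability
  makes the positive and negative parts of \<open>F\<close> finite, and they are recombined by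
  subtraction.\<close>

lemma mixture_integral:
  fixes F :: "'a \<Rightarrow> real" and T :: "nat \<Rightarrow> 'b \<Rightarrow> 'a"
  assumes mixture: "\<And>f. f \<in> borel_measurable P \<Longrightarrow> (\<integral>\<^sup>+c. f c \<partial>P) = (\<Sum>N. \<integral>\<^sup>+x. f (T N x) \<partial>M N)"
    and F [measurable]: "F \<in> borel_measurable P"
    and int: "\<And>N. integrable (M N) (\<lambda>x. F (T N x))"
    and summable: "summable (\<lambda>N. \<integral>x. \<bar>F (T N x)\<bar> \<partial>M N)"
  shows "integrable P F" and "(\<lambda>N. \<integral>x. F (T N x) \<partial>M N) sums (\<integral>c. F c \<partial>P)"
proof -
  \<comment> \<open>A general \<open>f\<close> with values between 0 and |z| treats the absolute
    value and the two parts at once.\<close>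
  have nn: "(\<integral>\<^sup>+c. ennreal (f (F c)) \<partial>P) = ennreal (\<Sum>N. \<integral>x. f (F (T N x)) \<partial>M N)"
    and summable_f: "summable (\<lambda>N. \<integral>x. f (F (T N x)) \<partial>M N)"
    if f: "f \<in> borel_measurable borel" "\<And>z. 0 \<le> f z" "\<And>z. f z \<le> \<bar>z\<bar>" for f :: "real \<Rightarrow> real"
  proof -
    have int_f: "integrable (M N) (\<lambda>x. f (F (T N x)))" for N
      using f by (intro Bochner_Integration.integrable_bound[OF int[of N]]
          measurable_compose[OF borel_measurable_integrable[OF int] f(1)]) auto
    have le: "(\<integral>x. f (F (T N x)) \<partial>M N) \<le> (\<integral>x. \<bar>F (T N x)\<bar> \<partial>M N)" for N
      using f int_f int by (intro integral_mono) auto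
    have nonneg: "0 \<le> (\<integral>x. f (F (T N x)) \<partial>M N)" for N
      using f by (intro integral_nonneg_AE) auto
    show s: "summable (\<lambda>N. \<integral>x. f (F (T N x)) \<partial>M N)"
      using le nonneg by (intro summable_comparison_test'[OF summable]) auto
    have "(\<integral>\<^sup>+c. ennreal (f (F c)) \<partial>P) = (\<Sum>N. \<integral>\<^sup>+x. ennreal (f (F (T N x))) \<partial>M N)"
      using f by (intro mixture) auto
    also have "\<dots> = (\<Sum>N. ennreal (\<integral>x. f (F (T N x)) \<partial>M N))"
      using f int_f by (intro suminf_cong nn_integral_eq_integral) auto
    also have "\<dots> = ennreal (\<Sum>N. \<integral>x. f (F (T N x)) \<partial>M N)"
      using s nonneg by (intro suminf_ennreal2) auto
    finally show "(\<integral>\<^sup>+c. ennreal (f (F c)) \<partial>P) = ennreal (\<Sum>N. \<integral>x. f (F (T N x)) \<partial>M N)" .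
  qed
  show integrable_F: "integrable P F"
    using nn[of abs] by (intro integrableI_bounded) auto
  let ?p = "\<lambda>z::real. max 0 z" and ?n = "\<lambda>z::real. max 0 (- z)"
  have p: "(\<integral>c. ?p (F c) \<partial>P) = (\<Sum>N. \<integral>x. ?p (F (T N x)) \<partial>M N)"
    and n: "(\<integral>c. ?n (F c) \<partial>P) = (\<Sum>N. \<integral>x. ?n (F (T N x)) \<partial>M N)"
    using nn[of ?p] nn[of ?n] summable_f[of ?p] summable_f[of ?n]
    by (auto simp: integral_eq_nn_integral intro!: enn2real_ennreal suminf_nonneg integral_nonneg_AE)
  have "(\<lambda>N. (\<integral>x. ?p (F (T N x)) \<partial>M N) - (\<integral>x. ?n (F (T N x)) \<partial>M N)) sums
      ((\<integral>c. ?p (F c) \<partial>P) - (\<integral>c. ?n (F c) \<partial>P))"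
    unfolding p n using summable_f[of ?p] summable_f[of ?n] by (intro sums_diff summable_sums) auto
  moreover note integral_pos_part_minus_neg_part[OF integrable_F] integral_pos_part_minus_neg_part[OF int]
  ultimately show "(\<lambda>N. \<integral>x. F (T N x) \<partial>M N) sums (\<integral>c. F c \<partial>P)"
    by simp
qed

section \<open>The grand canonical law as a mixture over the particle number\<close>

context
  fixes t lam :: real
  assumes lam: "lam > 0"
    and det_nonneg: "\<And>N x. 0 \<le> kernel_det (mns_phi t) N x"
    and det_integrable: "\<And>N. integrable (Pi\<^sub>M {..<N} (\<lambda>_. lborel)) (kernel_det (mns_phi t) N)"
    and summable_Z: "summable (\<lambda>N. lam ^ N / fact N * mns_Z_canonical t N)"
begin

lemma measurable_det [measurable]:
  "kernel_det (mns_phi t) N \<in> borel_measurable (Pi\<^sub>M {..<N} (\<lambda>_. lborel))"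
  using det_integrable by (rule borel_measurable_integrable)

lemma Z_canonical_nonneg: "0 \<le> mns_Z_canonical t N"
  unfolding mns_Z_canonical_def by (intro integral_nonneg_AE) (simp add: det_nonneg)

text \<open>The terms are nonnegative and the one for \<open>N = 0\<close> equals 1.\<close>

lemma Z_pos: "0 < mns_Z t lam"
proof -
  have "(\<Sum>N<1. lam ^ N / fact N * mns_Z_canonical t N) \<le> mns_Z t lam"
    unfolding mns_Z_def using lam Z_canonical_nonneg by (intro sum_le_suminf summable_Z) auto
  then show ?thesis by (simp add: mns_Z_canonical_0)
qed

lemma nn_integral_mns_canonical:
  assumes [measurable]: "f \<in> borel_measurable configuration_algebra"
  shows "(\<integral>\<^sup>+c. f c \<partial>mns_canonical t N) =
    (\<integral>\<^sup>+x. ennreal (1 / mns_Z_canonical t N * kernel_det (mns_phi t) N x) * f (configuration_of N x)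
       \<partial>Pi\<^sub>M {..<N} (\<lambda>_. lborel))"
  unfolding mns_canonical_def
  by (subst nn_integral_distr) (auto simp: nn_integral_density)

text \<open>The mass is only bounded by 1: a vanishing canonical partition function would, by the
  convention \<open>1 / 0 = 0\<close>, yield the null measure. A subprobability kernel is enough for
  the monadic bind.\<close>

lemma subprob_space_mns_canonical: "subprob_space (mns_canonical t N)"
proof
  have "emeasure (mns_canonical t N) (space (mns_canonical t N)) = (\<integral>\<^sup>+c. 1 \<partial>mns_canonical t N)"
    by simp
  also have "\<dots> = (\<integral>\<^sup>+x. ennreal (1 / mns_Z_canonical t N * kernel_det (mns_phi t) N x) \<partial>Pi\<^sub>M {..<N} (\<lambda>_. lborel))"
    by (subst nn_integral_mns_canonical) auto
  also have "\<dots> = ennreal (1 / mns_Z_canonical t N * mns_Z_canonical t N)"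
    unfolding mns_Z_canonical_def
    by (subst nn_integral_eq_integral)
      (auto intro!: integrable_mult_right divide_nonneg_nonneg det_integrable integral_nonneg_AE simp: det_nonneg)
  also have "\<dots> \<le> 1" by simp
  finally show "emeasure (mns_canonical t N) (space (mns_canonical t N)) \<le> 1" .
  have "(\<lambda>_. 0) \<in> space (mns_canonical t N)"
    by (simp add: mns_canonical_def space_configuration_algebra configurations_def)
  then show "space (mns_canonical t N) \<noteq> {}" by blast
qed

lemma measurable_mns_canonical:
  "mns_canonical t \<in> measurable (mns_particle_number t lam) (subprob_algebra configuration_algebra)"
proof -
  have "mns_canonical t N \<in> space (subprob_algebra configuration_algebra)" for N
    using subprob_space_mns_canonical by (simp add: space_subprob_algebra mns_canonical_def)
  then show ?thesis
    by (simp add: mns_particle_number_def measurable_density_eq1)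
qed

text \<open>The canonical normalisation cancels against the particle-number weight, leaving the
  unnormalised determinant divided by \<open>mns_Z t lam\<close> in each sector.\<close>

lemma nn_integral_mns_grand_canonical:
  assumes f [measurable]: "f \<in> borel_measurable configuration_algebra"
  shows "(\<integral>\<^sup>+c. f c \<partial>mns_grand_canonical t lam) =
    (\<Sum>N. \<integral>\<^sup>+x. f (configuration_of N x) \<partial>density (Pi\<^sub>M {..<N} (\<lambda>_. lborel))
       (\<lambda>x. ennreal (lam ^ N / fact N / mns_Z t lam * kernel_det (mns_phi t) N x)))"
proof -
  let ?p = "\<lambda>N. ennreal (lam ^ N / fact N * (mns_Z_canonical t N / mns_Z t lam))"
  have "(\<integral>\<^sup>+c. f c \<partial>mns_grand_canonical t lam) =
      (\<integral>\<^sup>+N. \<integral>\<^sup>+c. f c \<partial>mns_canonical t N \<partial>mns_particle_number t lam)"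
    unfolding mns_grand_canonical_def by (rule nn_integral_bind[OF f measurable_mns_canonical])
  also have "\<dots> = (\<Sum>N. ?p N * (\<integral>\<^sup>+c. f c \<partial>mns_canonical t N))"
    unfolding mns_particle_number_def
    by (subst nn_integral_density) (auto simp: nn_integral_count_space_nat)
  also have "\<dots> = (\<Sum>N. \<integral>\<^sup>+x. f (configuration_of N x) \<partial>density (Pi\<^sub>M {..<N} (\<lambda>_. lborel))
       (\<lambda>x. ennreal (lam ^ N / fact N / mns_Z t lam * kernel_det (mns_phi t) N x)))"
  proof (rule suminf_cong)
    fix N
    let ?d = "kernel_det (mns_phi t) N" and ?z = "mns_Z_canonical t N"
    let ?L = "Pi\<^sub>M {..<N} (\<lambda>_. lborel :: real measure)"
    \<comment> \<open>If \<open>?z = 0\<close>, the nonnegative determinant vanishes almost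
      everywhere, so both sides are 0 and the cancellation persists.\<close>
    have "AE x in ?L. ?p N * ennreal (1 / ?z * ?d x) = ennreal (lam ^ N / fact N / mns_Z t lam * ?d x)"
    proof (cases "?z = 0")
      case True
      then have "AE x in ?L. ?d x = 0"
        using integral_nonneg_eq_0_iff_AE[OF det_integrable, of N] by (simp add: det_nonneg mns_Z_canonical_def)
      then show ?thesis by eventually_elim simp
    next
      case False
      then show ?thesis
        using Z_pos lam Z_canonical_nonneg[of N]
        by (intro AE_I2) (simp flip: ennreal_mult add: det_nonneg)
    qed
    then have AE: "AE x in ?L. ?p N * (ennreal (1 / ?z * ?d x) * f (configuration_of N x)) =
        ennreal (lam ^ N / fact N / mns_Z t lam * ?d x) * f (configuration_of N x)"
      by eventually_elim (simp flip: mult.assoc)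
    have "?p N * (\<integral>\<^sup>+c. f c \<partial>mns_canonical t N) =
        (\<integral>\<^sup>+x. ?p N * (ennreal (1 / ?z * ?d x) * f (configuration_of N x)) \<partial>?L)"
      unfolding nn_integral_mns_canonical[OF f] by (rule nn_integral_cmult[symmetric]) measurable
    also have "\<dots> = (\<integral>\<^sup>+x. ennreal (lam ^ N / fact N / mns_Z t lam * ?d x) * f (configuration_of N x) \<partial>?L)"
      by (rule nn_integral_cong_AE[OF AE])
    also have "\<dots> = (\<integral>\<^sup>+x. f (configuration_of N x) \<partial>density ?L
       (\<lambda>x. ennreal (lam ^ N / fact N / mns_Z t lam * ?d x)))"
      by (rule nn_integral_density[symmetric]) measurable
    finally show "?p N * (\<integral>\<^sup>+c. f c \<partial>mns_canonical t N) = \<dots>" .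
  qed
  finally show ?thesis .
qed

lemma sets_mns_grand_canonical: "sets (mns_grand_canonical t lam) = sets configuration_algebra"
  unfolding mns_grand_canonical_def
  by (rule sets_bind) (auto simp: mns_canonical_def mns_particle_number_def)

text \<open>The total mass is the series of \<open>mns_Z t lam\<close> divided by its sum.\<close>

lemma point_process_mns_grand_canonical: "point_process (mns_grand_canonical t lam)"
proof -
  have "emeasure (mns_grand_canonical t lam) (space (mns_grand_canonical t lam)) =
      (\<integral>\<^sup>+c. 1 \<partial>mns_grand_canonical t lam)" by simp
  also have "\<dots> = (\<Sum>N. \<integral>\<^sup>+x. ennreal (lam ^ N / fact N / mns_Z t lam * kernel_det (mns_phi t) N x)
      \<partial>Pi\<^sub>M {..<N} (\<lambda>_. lborel))"
    by (subst nn_integral_mns_grand_canonical) (auto simp: emeasure_density)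
  also have "\<dots> = (\<Sum>N. ennreal (lam ^ N / fact N * mns_Z_canonical t N / mns_Z t lam))"
  proof (rule suminf_cong)
    fix N
    show "(\<integral>\<^sup>+x. ennreal (lam ^ N / fact N / mns_Z t lam * kernel_det (mns_phi t) N x) \<partial>Pi\<^sub>M {..<N} (\<lambda>_. lborel)) =
        ennreal (lam ^ N / fact N * mns_Z_canonical t N / mns_Z t lam)"
      using lam Z_pos det_integrable[of N]
      by (subst nn_integral_eq_integral) (auto simp: det_nonneg mns_Z_canonical_def)
  qed
  also have "\<dots> = ennreal (\<Sum>N. lam ^ N / fact N * mns_Z_canonical t N / mns_Z t lam)"
    using lam Z_pos summable_Z Z_canonical_nonneg by (intro suminf_ennreal2 summable_divide) auto
  also have "\<dots> = 1"
    using Z_pos unfolding suminf_divide[OF summable_Z] by (simp add: mns_Z_def)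
  finally show ?thesis
    by (simp add: point_process_def prob_spaceI sets_mns_grand_canonical)
qed

lemma expectation_mns_grand_canonical:
  assumes g [measurable]: "g \<in> borel_measurable borel" and K: "compact (closure {x. g x \<noteq> 0})"
    and int: "\<And>N. integrable (Pi\<^sub>M {..<N} (\<lambda>_. lborel)) (\<lambda>x. (\<Prod>i<N. 1 + g (x i)) * kernel_det (mns_phi t) N x)"
    and summable: "summable (\<lambda>N. lam ^ N / fact N *
       (\<integral>x. (\<Prod>i<N. \<bar>1 + g (x i)\<bar>) * kernel_det (mns_phi t) N x \<partial>Pi\<^sub>M {..<N} (\<lambda>_. lborel)))"
  shows "integrable (mns_grand_canonical t lam) (particle_product g)"
    and "(\<lambda>N. lam ^ N / fact N *
       (\<integral>x. (\<Prod>i<N. 1 + g (x i)) * kernel_det (mns_phi t) N x \<partial>Pi\<^sub>M {..<N} (\<lambda>_. lborel)) / mns_Z t lam)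
       sums (\<integral>c. particle_product g c \<partial>mns_grand_canonical t lam)"
proof -
  let ?L = "\<lambda>N. Pi\<^sub>M {..<N} (\<lambda>_. lborel :: real measure)" and ?d = "kernel_det (mns_phi t)"
  let ?c = "\<lambda>N. lam ^ N / fact N / mns_Z t lam"
  let ?M = "\<lambda>N. density (?L N) (\<lambda>x. ennreal (?c N * ?d N x))"
  have c: "0 \<le> ?c N" for N using lam Z_pos by simp
  have F: "particle_product g \<in> borel_measurable configuration_algebra"
    by (rule measurable_particle_product[OF g K]) (auto intro: closure_subset[THEN subsetD])
  then have F': "particle_product g \<in> borel_measurable (mns_grand_canonical t lam)"
    by (simp add: measurable_cong_sets[OF sets_mns_grand_canonical refl])
  note [measurable] = measurable_compose[OF measurable_configuration_of F]
  have int_M: "integrable (?M N) (\<lambda>x. particle_product g (configuration_of N x))" for N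
    using integrable_mult_right[OF int[of N], of "?c N"] c
    by (subst integrable_density)
      (auto simp: det_nonneg particle_product_configuration_of mult_ac
        intro!: AE_I2 divide_nonneg_pos mult_nonneg_nonneg zero_le_power less_imp_le[OF lam] Z_pos mult_pos_pos)
  have integral_M: "(\<integral>x. particle_product g (configuration_of N x) \<partial>?M N) =
      lam ^ N / fact N * (\<integral>x. (\<Prod>i<N. 1 + g (x i)) * ?d N x \<partial>?L N) / mns_Z t lam" for N
    using c by (subst integral_density) (auto simp: det_nonneg particle_product_configuration_of mult_ac
        intro!: AE_I2 divide_nonneg_pos mult_nonneg_nonneg zero_le_power less_imp_le[OF lam] Z_pos mult_pos_pos)
  have "(\<integral>x. \<bar>particle_product g (configuration_of N x)\<bar> \<partial>?M N) =
      lam ^ N / fact N * (\<integral>x. (\<Prod>i<N. \<bar>1 + g (x i)\<bar>) * ?d N x \<partial>?L N) / mns_Z t lam" for N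
    using c by (subst integral_density) (auto simp: det_nonneg particle_product_configuration_of mult_ac abs_prod
        intro!: AE_I2 divide_nonneg_pos mult_nonneg_nonneg zero_le_power less_imp_le[OF lam] Z_pos mult_pos_pos)
  then have summable_M: "summable (\<lambda>N. \<integral>x. \<bar>particle_product g (configuration_of N x)\<bar> \<partial>?M N)"
    using summable_divide[OF summable, of "mns_Z t lam"] by simp
  have mixture: "(\<integral>\<^sup>+c. f c \<partial>mns_grand_canonical t lam) = (\<Sum>N. \<integral>\<^sup>+x. f (configuration_of N x) \<partial>?M N)"
    if "f \<in> borel_measurable (mns_grand_canonical t lam)" for f
    using that by (intro nn_integral_mns_grand_canonical)
      (simp add: measurable_cong_sets[OF sets_mns_grand_canonical refl])
  show "integrable (mns_grand_canonical t lam) (particle_product g)"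
    by (rule mixture_integral(1)[where T = configuration_of and M = ?M, OF mixture F' int_M summable_M])
  show "(\<lambda>N. lam ^ N / fact N * (\<integral>x. (\<Prod>i<N. 1 + g (x i)) * ?d N x \<partial>?L N) / mns_Z t lam)
       sums (\<integral>c. particle_product g c \<partial>mns_grand_canonical t lam)"
    using mixture_integral(2)[where T = configuration_of and M = ?M, OF mixture F' int_M summable_M] by (simp only: integral_M)
qed

end

section \<open>The correlation kernel\<close>

text \<open>Admitting all weights below \<open>lam * q powr (real n + 1 / 2)\<close> covers both
  kernels of the main argument. The weights are dominated by a geometric series, and the diagonal
  series by the expansion of \<open>mns_phi t x x\<close>.\<close>

lemma mns_orthonormal_expansion:
  assumes q: "0 < q" "q < 1" and t: "t > 0" and b: "1 / (2 * t) = q / (1 - q)\<^sup>2"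
    and lam: "lam > 0" and w: "\<And>n. 0 \<le> w n" "\<And>n. w n \<le> lam * q powr (real n + 1 / 2)"
  shows "orthonormal_expansion (mns_psi q) w"
proof
  show "mns_psi q n \<in> borel_measurable borel" for n by (rule measurable_mns_psi)
  show "integrable lborel (\<lambda>x. mns_psi q i x * mns_psi q j x)"
    "(\<integral>x. mns_psi q i x * mns_psi q j x \<partial>lborel) = (if i = j then 1 else 0)" for i j
    using mns_psi_orthonormal[OF q, of i j] by (simp_all add: has_bochner_integral_iff)
  show "0 \<le> w n" for n by (rule w)
  have geometric: "summable (\<lambda>n. lam * (sqrt q * q ^ n))"
    using q by (intro summable_mult summable_geometric) auto
  have eq: "lam * q powr (real n + 1 / 2) = lam * (sqrt q * q ^ n)" for n
  proof -
    have "q powr (real n + 1 / 2) = q ^ n * sqrt q"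
      using q by (simp add: powr_add powr_realpow powr_half_sqrt)
    then show ?thesis by simp
  qed
  have "norm (w n) \<le> lam * (sqrt q * q ^ n)" for n
    using w(1)[of n] w(2)[of n, unfolded eq] by simp
  then show "summable w"
    by (rule summable_comparison_test'[OF geometric])
  fix x
  have "summable (\<lambda>n. lam * (q powr (real n + 1 / 2) * mns_psi q n x * mns_psi q n x))"
    using mns_phi_sums[OF q t b, of x x] by (intro summable_mult sums_summable)
  then show "summable (\<lambda>n. w n * (mns_psi q n x)\<^sup>2)"
  proof (rule summable_comparison_test')
    show "norm (w n * (mns_psi q n x)\<^sup>2) \<le> lam * (q powr (real n + 1 / 2) * mns_psi q n x * mns_psi q n x)" for n
      using mult_right_mono[OF w(2), of "(mns_psi q n x)\<^sup>2"] w(1)[of n]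
      by (simp add: power2_eq_square mult.assoc)
  qed
qed

theorem theorem1p7:
  fixes t b q lam :: real
  assumes "t > 0"
    and "b = 1 / (2 * t)"
    and "0 < q" and "q < 1"
    and "b = q / (1 - q)\<^sup>2"
    and "lam > 0"
  shows "(\<forall>x y. summable (mns_kernel_term q lam x y)) \<and>
         determinantal_point_process (mns_grand_canonical t lam) (mns_kernel q lam)"
proof -
  let ?mu = "\<lambda>n. lam * q powr (real n + 1 / 2)"
  let ?kappa = "\<lambda>n. ?mu n / (1 + ?mu n)"
  have q: "0 < q" "q < 1" and lam: "lam > 0" and t: "t > 0" and b: "1 / (2 * t) = q / (1 - q)\<^sup>2"
    using assms by auto
  have mu: "0 < ?mu n" for n
    using q lam by simp
  have kappa: "0 \<le> ?kappa n" "?kappa n \<le> ?mu n" for n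
    using mu[of n] mult_left_mono[of 1 "1 + ?mu n" "?mu n"]
    by (auto simp: divide_le_eq simp del: mult_le_cancel_left1 intro: divide_nonneg_nonneg)
  \<comment> \<open>Two expansions in the same functions: \<open>M\<close> has kernel
    \<open>lam * mns_phi t\<close> and governs the density, \<open>K\<close> has the claimed
    correlation kernel.\<close>
  interpret M: orthonormal_expansion "mns_psi q" ?mu
    using mu less_imp_le by (intro mns_orthonormal_expansion[OF q t b lam]) blast+
  interpret K: orthonormal_expansion "mns_psi q" ?kappa
    using kappa by (intro mns_orthonormal_expansion[OF q t b lam])
  let ?L = "\<lambda>N. Pi\<^sub>M {..<N} (\<lambda>_. lborel :: real measure)"

  have M_kernel: "M.kernel x y = lam * mns_phi t x y" for x y
    using sums_unique[OF sums_mult[OF mns_phi_sums[OF q t b], of lam x y]]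
    by (simp add: M.kernel_def mult.assoc)
  have M_det: "M.det_kernel N x = lam ^ N * kernel_det (mns_phi t) N x" for N x
    unfolding M_kernel kernel_det_eq_index_det by (simp add: index_det_scale_rows)
  have K_kernel: "K.kernel x y = mns_kernel q lam x y" for x y
    by (simp add: K.kernel_def mns_kernel_def mns_kernel_term_def)
  have K_det: "K.det_kernel N x = kernel_det (mns_kernel q lam) N x" for N x
    unfolding K_kernel kernel_det_eq_index_det ..

  have det_nonneg: "0 \<le> kernel_det (mns_phi t) N x" for N x
    using M.det_kernel_nonneg[of N x] zero_less_power[OF lam, of N] unfolding M_det
    by (simp add: zero_le_mult_iff)
  have det_int: "integrable (?L N) (kernel_det (mns_phi t) N)" for N
    using integrable_mult_right[OF M.integral_det_kernel_le(1)[of N], of "1 / lam ^ N"] lam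
    unfolding M_det by simp
  have M_integral: "1 / fact N * (\<integral>x. f x * M.det_kernel N x \<partial>?L N) =
      lam ^ N / fact N * (\<integral>x. f x * kernel_det (mns_phi t) N x \<partial>?L N)" for f N
    unfolding M_det mult.left_commute[of _ "lam ^ N"] by simp

  have gram_one: "M.gram (\<lambda>_. 1) i j = (if i = j then 1 else 0)" for i j
    by (simp add: M.gram_def M.orthonormal)
  \<comment> \<open>For \<open>h = 1\<close> the expansion is the series of the grand partition
    function, and the finite determinants are diagonal.\<close>
  note F1 = M.fredholm_expansion[of "\<lambda>_. 1" 1, unfolded M_integral, simplified gram_one]
  have Z_summable: "summable (\<lambda>N. lam ^ N / fact N * mns_Z_canonical t N)"
    using F1(2) by (simp add: mns_Z_canonical_def)
  have Z_lim: "(\<lambda>m. \<Prod>i<m. 1 + ?mu i) \<longlonglongrightarrow> mns_Z t lam"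
  proof -
    have "index_det {..<m} (\<lambda>i j. (if i = j then 1 else 0) + ?mu i * (if i = j then 1 else 0)) = (\<Prod>i<m. 1 + ?mu i)" for m
      by (subst index_det_diag) auto
    then show ?thesis
      using F1(3) by (simp add: mns_Z_def mns_Z_canonical_def)
  qed
  note process = lam det_nonneg det_int Z_summable
  have Z_pos: "mns_Z t lam > 0"
    by (rule Z_pos[OF process])

  have "has_correlation_functions (mns_grand_canonical t lam) (kernel_det (mns_kernel q lam))"
    unfolding has_correlation_functions_def
  proof (intro ballI impI, elim conjE, intro conjI)
    fix g :: "real \<Rightarrow> real"
    assume g [measurable]: "g \<in> borel_measurable borel" and bounded: "bounded (range g)"
      and compact: "compact (closure {x. g x \<noteq> 0})"
    obtain C where C: "\<bar>g x\<bar> \<le> C" for x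
      using bounded by (auto simp: bounded_iff)
    have C1: "\<bar>1 + g x\<bar> \<le> 1 + C" for x
      using C[of x] by linarith
    \<comment> \<open>Gram matrices do not depend on the weights, and by orthonormality the constant
      1 contributes the identity.\<close>
    have gram: "M.gram (\<lambda>x. 1 + g x) i j = (if i = j then 1 else 0) + K.gram g i j" for i j
    proof -
      have "M.gram (\<lambda>x. 1 + g x) i j =
          (\<integral>x. mns_psi q i x * mns_psi q j x + g x * (mns_psi q i x * mns_psi q j x) \<partial>lborel)"
        by (simp add: M.gram_def distrib_right)
      also have "\<dots> = (if i = j then 1 else 0) + K.gram g i j"
        using K.integrable_gram[OF g C] M.integrable_psi
        by (subst Bochner_Integration.integral_add) (auto simp: K.gram_def M.orthonormal)
      finally show ?thesis .
    qed
    note FM = M.fredholm_expansion[of "\<lambda>x. 1 + g x", OF _ C1, unfolded M_integral]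
    \<comment> \<open>The expansion for \<open>\<bar>1 + g\<bar>\<close> provides the absolute
      summability needed to integrate the signed particle product against the mixture.\<close>
    note FA = M.fredholm_expansion[of "\<lambda>x. \<bar>1 + g x\<bar>" "1 + C", unfolded M_integral]
    note FK = K.fredholm_expansion[OF g C, unfolded K_det]
    have int: "integrable (?L N) (\<lambda>x. (\<Prod>i<N. 1 + g (x i)) * kernel_det (mns_phi t) N x)" for N
    proof -
      have "integrable (?L N) (\<lambda>x. lam ^ N * ((\<Prod>i<N. 1 + g (x i)) * kernel_det (mns_phi t) N x))"
        using FM(1)[of N] unfolding M_det mult.left_commute[of _ "lam ^ N"] by simp
      then show ?thesis using lam by simp
    qed
    have abs_summable: "summable (\<lambda>N. lam ^ N / fact N *
        (\<integral>x. (\<Prod>i<N. \<bar>1 + g (x i)\<bar>) * kernel_det (mns_phi t) N x \<partial>?L N))"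
      using C1 by (intro FA(2)) auto
    note expectation = expectation_mns_grand_canonical[OF process g compact int abs_summable]
    show "integrable (mns_grand_canonical t lam) (particle_product g)"
      by (rule expectation(1))
    show "\<forall>k. integrable (?L k) (\<lambda>x. (\<Prod>j<k. g (x j)) * kernel_det (mns_kernel q lam) k x)"
      using FK(1) by simp
    let ?S = "\<Sum>N. lam ^ N / fact N * (\<integral>x. (\<Prod>i<N. 1 + g (x i)) * kernel_det (mns_phi t) N x \<partial>?L N)"
    let ?T = "\<Sum>k. 1 / fact k * (\<integral>x. (\<Prod>j<k. g (x j)) * kernel_det (mns_kernel q lam) k x \<partial>?L k)"
    txt \<open>With \<open>M = diag(\<mu>\<^sub>i)\<close>, \<open>D = diag(\<kappa>\<^sub>i)\<close> and the Gram matrix \<open>G\<close> of \<open>g\<close>: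
      \<open>I + M(I + G) = (I + M)(I + DG)\<close>.\<close>
    have "index_det {..<m} (\<lambda>i j. (if i = j then 1 else 0) + ?mu i * M.gram (\<lambda>x. 1 + g x) i j) =
        (\<Prod>i<m. 1 + ?mu i) * index_det {..<m} (\<lambda>i j. (if i = j then 1 else 0) + ?kappa i * K.gram g i j)" for m
    proof -
      have "(if i = j then 1 else 0) + ?mu i * M.gram (\<lambda>x. 1 + g x) i j =
          (1 + ?mu i) * ((if i = j then 1 else 0) + ?kappa i * K.gram g i j)" for i j
      proof -
        have "(1 + ?mu i) * ?kappa i = ?mu i" using mu[of i] by simp
        then have "(1 + ?mu i) * (?kappa i * K.gram g i j) = ?mu i * K.gram g i j"
          by (simp only: mult.assoc[symmetric])
        then show ?thesis
          unfolding gram by (simp only: distrib_left) (auto simp: distrib_right)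
      qed
      then show ?thesis by (simp only: index_det_scale_rows)
    qed
    moreover have "(\<lambda>m. (\<Prod>i<m. 1 + ?mu i) *
        index_det {..<m} (\<lambda>i j. (if i = j then 1 else 0) + ?kappa i * K.gram g i j)) \<longlonglongrightarrow> mns_Z t lam * ?T"
      by (intro tendsto_mult Z_lim FK(3))
    moreover have "(\<lambda>m. index_det {..<m} (\<lambda>i j. (if i = j then 1 else 0) + ?mu i * M.gram (\<lambda>x. 1 + g x) i j)) \<longlonglongrightarrow> ?S"
      by (rule FM(3)) simp
    \<comment> \<open>The factorisation holds for every \<open>m\<close>, so the limits of its two
      sides coincide.\<close>
    ultimately have "?S = mns_Z t lam * ?T"
      by (simp only: LIMSEQ_unique)
    moreover have "(\<integral>c. particle_product g c \<partial>mns_grand_canonical t lam) = ?S / mns_Z t lam"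
      using sums_unique[OF expectation(2)] suminf_divide[OF FM(2)] by simp
    ultimately have "(\<integral>c. particle_product g c \<partial>mns_grand_canonical t lam) = ?T"
      using Z_pos by simp
    then show "(\<lambda>k. 1 / fact k * (\<integral>x. (\<Prod>j<k. g (x j)) * kernel_det (mns_kernel q lam) k x \<partial>?L k))
        sums (\<integral>c. particle_product g c \<partial>mns_grand_canonical t lam)"
      using summable_sums[OF FK(2)] by simp
  qed
  moreover have "summable (mns_kernel_term q lam x y)" for x y
    using K.summable_kernel[of x y] by (simp add: mns_kernel_term_def[abs_def])
  ultimately show ?thesis
    using point_process_mns_grand_canonical[OF process]
    by (simp add: determinantal_point_process_def)
qed

end
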